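(* Let $d>1$, let $\mathbf x_1,\dots,\mathbf x_n\in\mathbb{R}^d$ be distinct design points, let $\lambda>0$, and for $\mathbf y\in\mathbb{R}^n$ let $(\hat{\boldsymbol\theta}(\mathbf y),\hat{\boldsymbol\xi}(\mathbf y))$, with $\hat{\boldsymbol\xi}=[\hat{\boldsymbol\xi}_1^\top,\dots,\hat{\boldsymbol\xi}_n^\top]^\top$, be the solution of the penalized multivariate convex least squares problem $$\min_{\boldsymbol\theta\in\mathbb{R}^n,\ \boldsymbol\xi=[\boldsymbol\xi_1^\top,\dots,\boldsymbol\xi_n^\top]^\top\in\mathbb{R}^{nd}}\ \tfrac12\|\boldsymbol\theta-\mathbf y\|_2^2+\tfrac\lambda2\sum_{j=1}^n\|\boldsymbol\xi_j\|_2^2\quad\text{s.t.}\quad\langle\boldsymbol\xi_j,\mathbf x_k-\mathbf x_j\rangle\le\theta_k-\theta_j\quad\forall\, j\ne k.$$ Let $J_{\mathbf y}:=\{(j,k): j\neq k,\ \langle\hat{\boldsymbol\xi}_j,\mathbf x_k-\mathbf x_j\rangle=\hat\theta_k-\hat\theta_j\}$ and let $I_{\mathbf y}\subseteq J_{\mathbf y}$ be the index set of a maximal set of linearly independent rows of $[A_{J_{\mathbf y}},B_{J_{\mathbf y}}]$, where $A$ and $B$ are the matrices defined in the context. Then for almost every $\mathbf y\in\mathbb{R}^n$, $$D(\mathbf y)=n-\mathrm{trace}\Big(B_{I_{\mathbf y}}^\top\big(B_{I_{\mathbf y}}B_{I_{\mathbf y}}^\top+\tfrac1\lambda A_{I_{\mathbf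 y}}A_{I_{\mathbf y}}^\top\big)^{-1}B_{I_{\mathbf y}}\Big),$$ and $\mathrm{df}(\hat{\boldsymbol\theta}(\mathbf y))=\mathbb{E}[D(\mathbf y)]$.
   Context: $A$ is the $[n(n-1)]\times nd$ matrix whose rows are indexed by ordered pairs $r=(j,k)$, $j\ne k\in\{1,\dots,n\}$, and whose columns are partitioned into $n$ blocks of width $d$: the block of row $(j,k)$ and column block $j'\in\{1,\dots,n\}$ is $\mathbf x_k^\top-\mathbf x_j^\top$ if $j'=j$, and $\mathbf 0^\top$ otherwise. $B$ is the $[n(n-1)]\times n$ matrix with rows indexed in the same way, whose entry in row $(j,k)$ and column $c$ is $1$ if $c=j$, $-1$ if $c=k$, and $0$ otherwise. (Thus the constraints read $A\boldsymbol\xi+B\boldsymbol\theta\le\mathbf 0$.) For a set $J$ of row indices, $A_J,B_J$ are the submatrices with rows in $J$. The divergence is $D(\mathbf y):=\sum_{i=1}^n\frac{\partial}{\partial y_i}\hat\theta_i(\mathbf y)$. For the degrees of freedom, $\mathbf y=\boldsymbol\theta^*+\boldsymbol\epsilon$ with $\boldsymbol\theta^*\in\mathbb{R}^n$ fixed, $\boldsymbol\epsilon\sim N(\mathbf 0,\sigma^2I_n)$, $\sigma>0$, and $\mathrm{df}(\hat{\boldsymbol\theta}(\mathbf y)):=\frac1{\sigma^2}\sum_{i=1}^n\mathrm{Cov}(\hat\theta_i(\mathbf y),y_i)$. *)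

theory Defs
  imports "HOL-Probability.Probability"
begin

section \<open>Matrices over arbitrary finite index sets\<close>

text \<open>
  A matrix is a function from row indices to column indices to entries; its row and column index
  sets are supplied by the operations that sum over them. In this way the submatrix of \<open>M\<close>
  with rows in \<open>I\<close> is \<open>M\<close> itself, read with row index set \<open>I\<close>. (The row
  set needed below depends on a point of the sample space and may be empty, so that it cannot be an
  index type.)
\<close>

type_synonym ('r, 'c) matr = "'r \<Rightarrow> 'c \<Rightarrow> real"

definition mtransp :: "('r, 'c) matr \<Rightarrow> ('c, 'r) matr" where
  "mtransp M = (\<lambda>c r. M r c)"

text \<open>\<open>mprod K M N\<close> is the product of \<open>M\<close> and \<open>N\<close>, where
  \<open>K\<close> indexes the columns of \<open>M\<close> and the rows of \<open>N\<close>.\<close>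

definition mprod :: "'k set \<Rightarrow> ('r, 'k) matr \<Rightarrow> ('k, 'c) matr \<Rightarrow> ('r, 'c) matr" where
  "mprod K M N = (\<lambda>r c. \<Sum>k\<in>K. M r k * N k c)"

definition mtrace :: "'r set \<Rightarrow> ('r, 'r) matr \<Rightarrow> real" where
  "mtrace K M = (\<Sum>k\<in>K. M k k)"

definition is_minv :: "'r set \<Rightarrow> ('r, 'r) matr \<Rightarrow> ('r, 'r) matr \<Rightarrow> bool" where
  "is_minv I M W \<longleftrightarrow>
     (\<forall>r\<in>I. \<forall>s\<in>I. mprod I M W r s = (if r = s then 1 else 0)
                   \<and> mprod I W M r s = (if r = s then 1 else 0))"

definition minvertible :: "'r set \<Rightarrow> ('r, 'r) matr \<Rightarrow> bool" where
  "minvertible I M \<longleftrightarrow> (\<exists>W. is_minv I M W)"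

text \<open>The entries of the inverse are determined on \<open>I \<times> I\<close> only.\<close>

definition minv :: "'r set \<Rightarrow> ('r, 'r) matr \<Rightarrow> ('r, 'r) matr" where
  "minv I M = (SOME W. is_minv I M W)"

text \<open>\<open>[A, B]\<close>: the columns are those of \<open>A\<close> followed by those of
  \<open>B\<close>.\<close>

definition mappend :: "('r, 'c) matr \<Rightarrow> ('r, 'e) matr \<Rightarrow> ('r, 'c + 'e) matr" where
  "mappend A B = (\<lambda>r. case_sum (A r) (B r))"

definition mrow :: "('r, 'c::finite) matr \<Rightarrow> 'r \<Rightarrow> real ^ 'c" where
  "mrow M r = (\<chi> c. M r c)"

text \<open>Linear independence of the family of rows with indices in \<open>I\<close>, so that a row
  may not be repeated.\<close>

definition indep_rows :: "('r, 'c::finite) matr \<Rightarrow> 'r set \<Rightarrow> bool" where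
  "indep_rows M I \<longleftrightarrow> inj_on (mrow M) I \<and> independent (mrow M ` I)"

definition max_indep_rows :: "('r, 'c::finite) matr \<Rightarrow> 'r set \<Rightarrow> 'r set \<Rightarrow> bool" where
  "max_indep_rows M J I \<longleftrightarrow>
     I \<subseteq> J \<and> indep_rows M I \<and> (\<forall>I'. I \<subset> I' \<and> I' \<subseteq> J \<longrightarrow> \<not> indep_rows M I')"

section \<open>Penalized multivariate convex least squares\<close>

text \<open>
  The design points are \<open>x :: 'n \<Rightarrow> real ^ 'd\<close>, with \<open>CARD('n)\<close> the
  number of points and \<open>CARD('d)\<close> the dimension of the covariates. The pair
  \<open>(\<theta>, \<xi>)\<close> consists of the fitted values and the subgradients, with
  \<open>\<xi> $ j\<close> the subgradient at the \<open>j\<close>-th design point.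
\<close>

definition pcls_feasible ::
  "('n::finite \<Rightarrow> real ^ 'd::finite) \<Rightarrow> (real ^ 'n) \<times> (real ^ 'd ^ 'n) \<Rightarrow> bool" where
  "pcls_feasible x = (\<lambda>(\<theta>, \<xi>).
     \<forall>j k. j \<noteq> k \<longrightarrow> (\<xi> $ j) \<bullet> (x k - x j) \<le> \<theta> $ k - \<theta> $ j)"

definition pcls_objective ::
  "real \<Rightarrow> real ^ 'n::finite \<Rightarrow> (real ^ 'n) \<times> (real ^ 'd::finite ^ 'n) \<Rightarrow> real" where
  "pcls_objective lam y = (\<lambda>(\<theta>, \<xi>).
     1 / 2 * (norm (\<theta> - y))\<^sup>2 + lam / 2 * (\<Sum>j\<in>UNIV. (norm (\<xi> $ j))\<^sup>2))"

definition pcls_solution ::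
  "('n::finite \<Rightarrow> real ^ 'd::finite) \<Rightarrow> real \<Rightarrow> real ^ 'n \<Rightarrow> (real ^ 'n) \<times> (real ^ 'd ^ 'n)" where
  "pcls_solution x lam y = arg_min (pcls_objective lam y) (pcls_feasible x)"

definition theta_hat ::
  "('n::finite \<Rightarrow> real ^ 'd::finite) \<Rightarrow> real \<Rightarrow> real ^ 'n \<Rightarrow> real ^ 'n" where
  "theta_hat x lam y = fst (pcls_solution x lam y)"

definition xi_hat ::
  "('n::finite \<Rightarrow> real ^ 'd::finite) \<Rightarrow> real \<Rightarrow> real ^ 'n \<Rightarrow> real ^ 'd ^ 'n" where
  "xi_hat x lam y = snd (pcls_solution x lam y)"

text \<open>
  The column \<open>(j', l)\<close> of \<open>A\<close> is the \<open>l\<close>-th column of the block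
  \<open>j'\<close>. The row index set of \<open>A\<close> and \<open>B\<close> is
  \<open>{(j, k). j \<noteq> k}\<close>; their values on the diagonal pairs have no meaning.
\<close>

definition A_mat :: "('n \<Rightarrow> real ^ 'd) \<Rightarrow> ('n \<times> 'n, 'n \<times> 'd) matr" where
  "A_mat x = (\<lambda>(j, k) (j', l). if j' = j then (x k - x j) $ l else 0)"

definition B_mat :: "('n \<times> 'n, 'n) matr" where
  "B_mat = (\<lambda>(j, k) c. if c = j then 1 else if c = k then -1 else 0)"

definition active_set ::
  "('n::finite \<Rightarrow> real ^ 'd::finite) \<Rightarrow> real \<Rightarrow> real ^ 'n \<Rightarrow> ('n \<times> 'n) set" where
  "active_set x lam y = {(j, k). j \<noteq> k \<and>
     (xi_hat x lam y $ j) \<bullet> (x k - x j) = theta_hat x lam y $ k - theta_hat x lam y $ j}"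

text \<open>\<open>B_I B_I\<^sup>T + (1/\<lambda>) A_I A_I\<^sup>T\<close>, to be read with row and column index set
  \<open>I\<close>.\<close>

definition gram_mat ::
  "('n::finite \<Rightarrow> real ^ 'd::finite) \<Rightarrow> real \<Rightarrow> ('n \<times> 'n, 'n \<times> 'n) matr" where
  "gram_mat x lam = (\<lambda>r s. mprod UNIV B_mat (mtransp B_mat) r s
     + 1 / lam * mprod UNIV (A_mat x) (mtransp (A_mat x)) r s)"

section \<open>Divergence and degrees of freedom\<close>

text \<open>The \<open>i\<close>-th partial derivative at \<open>y\<close> of the \<open>i\<close>-th component of
  \<open>f\<close> is the derivative at \<open>0\<close> of \<open>coord_line f y i\<close>.\<close>

definition coord_line :: "(real ^ 'n::finite \<Rightarrow> real ^ 'n) \<Rightarrow> real ^ 'n \<Rightarrow> 'n \<Rightarrow> real \<Rightarrow> real" where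
  "coord_line f y i = (\<lambda>t. f (y + t *\<^sub>R axis i 1) $ i)"

definition divergence :: "(real ^ 'n::finite \<Rightarrow> real ^ 'n) \<Rightarrow> real ^ 'n \<Rightarrow> real" where
  "divergence f y = (\<Sum>i\<in>UNIV. deriv (coord_line f y i) 0)"

definition covar :: "'w measure \<Rightarrow> ('w \<Rightarrow> real) \<Rightarrow> ('w \<Rightarrow> real) \<Rightarrow> real" where
  "covar M X Y = (\<integral>w. (X w - (\<integral>v. X v \<partial>M)) * (Y w - (\<integral>v. Y v \<partial>M)) \<partial>M)"

text \<open>\<open>\<epsilon> \<sim> N(0, \<sigma>\<^sup>2 I_n)\<close>, by its joint density.\<close>

definition isotropic_normal :: "'w measure \<Rightarrow> real \<Rightarrow> ('w \<Rightarrow> real ^ 'n::finite) \<Rightarrow> bool" where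
  "isotropic_normal M \<sigma> \<epsilon> \<longleftrightarrow>
     distributed M lborel \<epsilon> (\<lambda>e. ennreal (\<Prod>i\<in>UNIV. normal_density 0 \<sigma> (e $ i)))"

definition deg_freedom ::
  "'w measure \<Rightarrow> real \<Rightarrow> (real ^ 'n::finite \<Rightarrow> real ^ 'n) \<Rightarrow> ('w \<Rightarrow> real ^ 'n) \<Rightarrow> real" where
  "deg_freedom M \<sigma> f Y = 1 / \<sigma>\<^sup>2 * (\<Sum>i\<in>UNIV. covar M (\<lambda>w. f (Y w) $ i) (\<lambda>w. Y w $ i))"

end

theory Submission
  imports Defs
begin

text \<open>
  In the variables \<open>z = (\<theta>, \<surd>\<lambda> \<xi>)\<close> the problem asks for the point of a polyhedral cone
  \<open>C = {z. a\<^sub>r \<bullet> z \<le> 0 for all r}\<close> nearest to \<open>(y, 0)\<close> (\<open>scaled_solution_eq\<close>). So the fitted values are a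
  nonexpansive function of \<open>y\<close>.

  \<^bold>\<open>Divergence.\<close> The normal cone of \<open>C\<close> at \<open>z\<close> depends only on the set of rows active at
  \<open>z\<close>. Hence, for each set \<open>J\<close>, the points whose projection has exactly the active rows
  \<open>J\<close> form a convex set (\<open>convex_projection_piece\<close>), and so do the \<open>y\<close> with active set
  \<open>J\<close>, the preimage of such a piece under the linear map \<open>y \<mapsto> (y, 0)\<close>. Genericity is thus decided
  inside the space of the \<open>y\<close>, not in the larger space of the \<open>z\<close>, in which the points
  \<open>(y, 0)\<close> form a null set. Since frontiers of convex sets are null, almost every \<open>y\<close> lies in the interior of
  its piece (\<open>AE_interior_active_set\<close>). There the solution is orthogonal to the active rows and the residual
  lies in their span (\<open>residual_in_span_active_rows\<close>), which is also the span of a maximal independent subset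
  \<open>I\<close>. So locally the residual is the orthogonal projection of \<open>(y, 0)\<close> onto a fixed subspace; written with the
  inverse of the Gram matrix of the rows in \<open>I\<close>, its first component is
  \<open>B\<^sub>I\<^sup>T (B\<^sub>I B\<^sub>I\<^sup>T + A\<^sub>I A\<^sub>I\<^sup>T / \<lambda>)\<^sup>-\<^sup>1 B\<^sub>I y\<close> (\<open>theta_hat_eq_projection\<close>), and the divergence is \<open>n\<close> minus
  the trace of the matrix in front of \<open>y\<close>. Degenerate points, at which some multipliers of active rows vanish, are treated like all others,
  because the pieces are indexed by the active rows and not by the support of the multipliers.

  \<^bold>\<open>Degrees of freedom.\<close> This is Stein's identity
  \<open>E[g(\<epsilon>) \<epsilon>\<^sub>i] = \<sigma>\<^sup>2 E[\<partial>\<^sub>i g(\<epsilon>)]\<close> for Lipschitz \<open>g\<close> with an almost everywhere defined partial derivative, applied to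
  the components of the estimator (\<open>stein_identity_lipschitz\<close>). It follows by moving a translation from
  \<open>g\<close> to the Gaussian density and passing to the limit in the difference quotients.
\<close>

section \<open>Projection onto a polyhedral cone\<close>

definition polyhedral_cone :: "('r \<Rightarrow> 'a::real_inner) \<Rightarrow> 'r set \<Rightarrow> 'a set" where
  "polyhedral_cone a R = {z. \<forall>r\<in>R. a r \<bullet> z \<le> 0}"

definition active_rows :: "('r \<Rightarrow> 'a::real_inner) \<Rightarrow> 'r set \<Rightarrow> 'a \<Rightarrow> 'r set" where
  "active_rows a R z = {r\<in>R. a r \<bullet> z = 0}"

definition normal_cone :: "'a::real_inner set \<Rightarrow> 'a \<Rightarrow> 'a set" where
  "normal_cone C z = {u. \<forall>w\<in>C. u \<bullet> (w - z) \<le> 0}"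

lemma closed_polyhedral_cone: "closed (polyhedral_cone a R)"
proof -
  have "polyhedral_cone a R = (\<Inter>r\<in>R. {z. a r \<bullet> z \<le> 0})"
    by (auto simp: polyhedral_cone_def)
  then show ?thesis
    by (auto intro!: closed_INT closed_halfspace_le)
qed

lemma convex_polyhedral_cone: "convex (polyhedral_cone a R)"
proof -
  have "polyhedral_cone a R = (\<Inter>r\<in>R. {z. a r \<bullet> z \<le> 0})"
    by (auto simp: polyhedral_cone_def)
  then show ?thesis
    by (auto intro!: convex_INT convex_halfspace_le)
qed

lemma zero_in_polyhedral_cone: "0 \<in> polyhedral_cone a R"
  by (simp add: polyhedral_cone_def)

lemma closest_point_iff_normal_cone:
  fixes C :: "'a::euclidean_space set"
  assumes "closed C" "convex C" "C \<noteq> {}"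
  shows "closest_point C v = z \<longleftrightarrow> z \<in> C \<and> v - z \<in> normal_cone C z"
proof
  assume "closest_point C v = z"
  then show "z \<in> C \<and> v - z \<in> normal_cone C z"
    using closest_point_dot[OF assms(2,1)] closest_point_in_set[OF assms(1,3)]
    by (auto simp: normal_cone_def)
next
  assume *: "z \<in> C \<and> v - z \<in> normal_cone C z"
  have "dist v z \<le> dist v w" if "w \<in> C" for w
  proof -
    have "(v - z) \<bullet> (w - z) \<le> 0" using * that by (simp add: normal_cone_def)
    then have "(v - z) \<bullet> (v - z) \<le> (v - w) \<bullet> (v - w)"
      using inner_ge_zero[of "w - z"] by (simp add: inner_diff inner_commute)
    then show ?thesis
      by (simp add: dist_norm norm_eq_sqrt_inner)
  qed
  then show "closest_point C v = z"
    using closest_point_unique[OF assms(2,1)] * by metis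
qed

lemma polyhedral_cone_step:
  assumes "finite R" "z \<in> polyhedral_cone a R"
    and "\<And>r. r \<in> active_rows a R z \<Longrightarrow> a r \<bullet> d \<le> 0"
  obtains t where "t > 0" "z + t *\<^sub>R d \<in> polyhedral_cone a R"
proof -
  have "\<forall>\<^sub>F t in at_right (0::real). a r \<bullet> (z + t *\<^sub>R d) \<le> 0" if "r \<in> R" for r
  proof (cases "a r \<bullet> z = 0")
    case True
    then have "a r \<bullet> d \<le> 0" using assms(3) that by (simp add: active_rows_def)
    with True show ?thesis
      by (auto simp: eventually_at_right_field inner_add_right mult_nonneg_nonpos
          intro!: exI[of _ 1])
  next
    case False
    then have "a r \<bullet> z < 0" using assms(2) that by (simp add: polyhedral_cone_def less_le)
    moreover have "((\<lambda>t. a r \<bullet> (z + t *\<^sub>R d)) \<longlongrightarrow> a r \<bullet> (z + 0 *\<^sub>R d)) (at_right 0)"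
      by (intro tendsto_intros)
    ultimately have "\<forall>\<^sub>F t in at_right 0. a r \<bullet> (z + t *\<^sub>R d) < 0"
      by (intro order_tendstoD(2)) auto
    then show ?thesis by eventually_elim simp
  qed
  then have "\<forall>\<^sub>F t in at_right (0::real). \<forall>r\<in>R. a r \<bullet> (z + t *\<^sub>R d) \<le> 0"
    using assms(1) by (simp add: eventually_ball_finite_distrib)
  then have "\<forall>\<^sub>F t in at_right (0::real). 0 < t \<and> z + t *\<^sub>R d \<in> polyhedral_cone a R"
    using eventually_at_right_less[of "0::real"]
    by eventually_elim (simp add: polyhedral_cone_def)
  then obtain t :: real where "0 < t \<and> z + t *\<^sub>R d \<in> polyhedral_cone a R"
    using eventually_happens'[OF trivial_limit_at_right_real] by blast
  then show thesis using that by blast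
qed

text \<open>
  At a point of a polyhedral cone the inactive constraints are strict, so a direction that does not
  increase any active row stays in the cone for a short while, and a normal vector cannot point
  along it. This is the only form in which the facial structure of the cone is used; it spares the
  representation of normals by nonnegative multipliers (Farkas).
\<close>

lemma normal_cone_nonpos_direction:
  assumes "finite R" "z \<in> polyhedral_cone a R" "u \<in> normal_cone (polyhedral_cone a R) z"
    and "\<And>r. r \<in> active_rows a R z \<Longrightarrow> a r \<bullet> d \<le> 0"
  shows "u \<bullet> d \<le> 0"
proof -
  obtain t where "t > 0" "z + t *\<^sub>R d \<in> polyhedral_cone a R"
    using polyhedral_cone_step[OF assms(1,2,4)] by blast
  then have "u \<bullet> (z + t *\<^sub>R d - z) \<le> 0"
    using assms(3) unfolding normal_cone_def by blast
  with \<open>t > 0\<close> show ?thesis by (simp add: mult_le_0_iff)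
qed

text \<open>
  The normal cone depends on the point through its active rows only: the direction from \<open>z'\<close>
  to any point \<open>w\<close> of the cone does not increase the rows active at \<open>z'\<close>, hence is
  admissible at every point \<open>z\<close> with no further active rows.
\<close>

lemma normal_cone_mono_active_rows:
  assumes "finite R" "z \<in> polyhedral_cone a R" "z' \<in> polyhedral_cone a R"
    and "active_rows a R z \<subseteq> active_rows a R z'"
  shows "normal_cone (polyhedral_cone a R) z \<subseteq> normal_cone (polyhedral_cone a R) z'"
proof
  fix u assume u: "u \<in> normal_cone (polyhedral_cone a R) z"
  have "u \<bullet> (w - z') \<le> 0" if "w \<in> polyhedral_cone a R" for w
  proof (rule normal_cone_nonpos_direction[OF assms(1,2) u])
    fix r assume "r \<in> active_rows a R z"
    with assms(4) that show "a r \<bullet> (w - z') \<le> 0"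
      by (auto simp: active_rows_def polyhedral_cone_def inner_diff_right)
  qed
  then show "u \<in> normal_cone (polyhedral_cone a R) z'"
    by (simp add: normal_cone_def)
qed

text \<open>
  Points with the same active rows \<open>J\<close> share one normal cone \<open>N\<close>, so the points whose
  projection has active rows \<open>J\<close> form the Minkowski sum of the convex set of cone points with
  active rows \<open>J\<close> and the convex set \<open>N\<close>.
\<close>

lemma convex_projection_piece:
  fixes a :: "'r \<Rightarrow> 'a::euclidean_space"
  assumes "finite R"
  shows "convex {v. active_rows a R (closest_point (polyhedral_cone a R) v) = J}"
    (is "convex ?S")
proof (rule convexI)
  let ?C = "polyhedral_cone a R" and ?P = "closest_point (polyhedral_cone a R)"
  note proj = closest_point_iff_normal_cone[OF closed_polyhedral_cone convex_polyhedral_cone, of a R]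
  have ne: "?C \<noteq> {}" using zero_in_polyhedral_cone by blast
  fix v v' and s t :: real
  assume v: "v \<in> ?S" "v' \<in> ?S" and st: "0 \<le> s" "0 \<le> t" "s + t = 1"
  define z z' where "z = ?P v" and "z' = ?P v'"
  define w where "w = s *\<^sub>R z + t *\<^sub>R z'"
  have z: "z \<in> ?C" "v - z \<in> normal_cone ?C z" "active_rows a R z = J"
    and z': "z' \<in> ?C" "v' - z' \<in> normal_cone ?C z'" "active_rows a R z' = J"
    using v proj[OF ne] by (auto simp: z_def z'_def)
  have w: "w \<in> ?C"
    unfolding w_def by (rule convexD[OF convex_polyhedral_cone z(1) z'(1) st])
  have act: "active_rows a R w = J"
  proof -
    have "a r \<bullet> w = 0 \<longleftrightarrow> r \<in> J" if r: "r \<in> R" for r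
    proof -
      have nonpos: "a r \<bullet> z \<le> 0" "a r \<bullet> z' \<le> 0"
        using z(1) z'(1) r by (auto simp: polyhedral_cone_def)
      have J: "r \<in> J \<longleftrightarrow> a r \<bullet> z = 0" "r \<in> J \<longleftrightarrow> a r \<bullet> z' = 0"
        using z(3) z'(3) r by (auto simp: active_rows_def)
      have eq: "a r \<bullet> w = s * (a r \<bullet> z) + t * (a r \<bullet> z')"
        by (simp add: w_def inner_add_right)
      show ?thesis
      proof
        assume "a r \<bullet> w = 0"
        \<comment> \<open>A sum of nonpositive terms vanishes only if both do; one of the weights \<open>s\<close>, \<open>t\<close> is positive.\<close>
        moreover have "s * (a r \<bullet> z) \<le> 0" "t * (a r \<bullet> z') \<le> 0"
          using st nonpos by (auto simp: mult_nonneg_nonpos)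
        ultimately have "s * (a r \<bullet> z) = 0" "t * (a r \<bullet> z') = 0" using eq by linarith+
        with st J show "r \<in> J" by auto
      next
        assume "r \<in> J"
        with J eq show "a r \<bullet> w = 0" by simp
      qed
    qed
    moreover have "J \<subseteq> R" using z(3) by (auto simp: active_rows_def)
    ultimately show ?thesis by (auto simp: active_rows_def)
  qed
  have "v - z \<in> normal_cone ?C w" "v' - z' \<in> normal_cone ?C w"
    using normal_cone_mono_active_rows[OF assms z(1) w] normal_cone_mono_active_rows[OF assms z'(1) w]
      z z' act by auto
  then have "s *\<^sub>R (v - z) + t *\<^sub>R (v' - z') \<in> normal_cone ?C w"
    using st by (auto simp: normal_cone_def inner_add_left intro!: add_nonpos_nonpos mult_nonneg_nonpos)
  moreover have "s *\<^sub>R (v - z) + t *\<^sub>R (v' - z') = (s *\<^sub>R v + t *\<^sub>R v') - w"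
    by (simp add: w_def algebra_simps)
  ultimately have "?P (s *\<^sub>R v + t *\<^sub>R v') = w"
    using proj[OF ne] w by simp
  with act show "s *\<^sub>R v + t *\<^sub>R v' \<in> ?S" by simp
qed

text \<open>
  The component of the residual orthogonal to all active rows is an admissible direction, along
  which the residual, being normal, cannot point; so this component vanishes.
\<close>

lemma residual_in_span_active_rows:
  fixes a :: "'r \<Rightarrow> 'a::euclidean_space"
  assumes "finite R" and "z = closest_point (polyhedral_cone a R) v"
  shows "v - z \<in> span (a ` active_rows a R z)"
proof -
  let ?C = "polyhedral_cone a R"
  have "?C \<noteq> {}" using zero_in_polyhedral_cone by blast
  then have z: "z \<in> ?C" "v - z \<in> normal_cone ?C z"
    using closest_point_iff_normal_cone[OF closed_polyhedral_cone convex_polyhedral_cone, of a R v z] assms(2)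
    by auto
  obtain p q where pq: "p \<in> span (a ` active_rows a R z)"
    "\<And>w. w \<in> span (a ` active_rows a R z) \<Longrightarrow> orthogonal q w" "v - z = p + q"
    using orthogonal_subspace_decomp_exists by blast
  have "a r \<bullet> q = 0" if "r \<in> active_rows a R z" for r
    using pq(2)[OF span_base[OF imageI[OF that]]] by (simp add: orthogonal_def inner_commute)
  then have "(v - z) \<bullet> q \<le> 0"
    by (intro normal_cone_nonpos_direction[OF assms(1) z]) simp
  moreover have "p \<bullet> q = 0"
    using pq(2)[OF pq(1)] by (simp add: orthogonal_def inner_commute)
  ultimately have "q \<bullet> q \<le> 0" using pq(3) by (simp add: inner_add_left)
  then have "q = 0" by (metis inner_eq_zero_iff inner_ge_zero order_antisym)
  with pq show ?thesis by simp
qed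

text \<open>
  The exceptional points lie on the frontiers of the finitely many convex sets, and the frontier of
  a convex set is a null set. It is applied to sets with no control on their dimension: a piece
  with empty interior lies inside its own frontier and is discarded with it.
\<close>

lemma AE_interior_of_finite_convex_cover:
  fixes S :: "'b \<Rightarrow> 'a::euclidean_space set"
  assumes "finite \<J>" "\<And>J. J \<in> \<J> \<Longrightarrow> convex (S J)" "\<And>y. \<exists>J\<in>\<J>. y \<in> S J"
  shows "AE y in lborel. \<exists>J\<in>\<J>. y \<in> interior (S J)"
proof -
  have "AE y in lborel. y \<notin> frontier (S J)" if "J \<in> \<J>" for J
  proof -
    have "frontier (S J) \<in> null_sets lebesgue"
      using negligible_convex_frontier[OF assms(2)[OF that]] negligible_iff_null_sets by blast
    moreover have "frontier (S J) \<in> sets lborel"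
      by (simp add: borel_closed)
    ultimately show ?thesis
      by (intro AE_not_in) (simp add: null_sets_completion_iff)
  qed
  then have "AE y in lborel. \<forall>J\<in>\<J>. y \<notin> frontier (S J)"
    using assms(1) by (simp add: AE_finite_all)
  then show ?thesis
  proof eventually_elim
    case (elim y)
    obtain J where J: "J \<in> \<J>" "y \<in> S J" using assms(3) by blast
    with elim have "y \<in> interior (S J)"
      using closure_subset by (fastforce simp: frontier_def)
    with J show ?case by blast
  qed
qed

section \<open>Gram matrices of independent families\<close>

text \<open>
  The dual vector of \<open>a r\<close> is the component of \<open>a r\<close> orthogonal to the span of the other
  vectors, rescaled; linear independence says that this component is not zero.
\<close>

lemma dual_basis_exists:
  fixes a :: "'r \<Rightarrow> 'a::euclidean_space"
  assumes "inj_on a I" "independent (a ` I)"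
  obtains w where "\<And>r. r \<in> I \<Longrightarrow> w r \<in> span (a ` I)"
    "\<And>r s. r \<in> I \<Longrightarrow> s \<in> I \<Longrightarrow> w r \<bullet> a s = (if r = s then 1 else 0)"
proof -
  have "\<exists>w. w \<in> span (a ` I) \<and> (\<forall>s\<in>I. w \<bullet> a s = (if r = s then 1 else 0))" if r: "r \<in> I" for r
  proof -
    let ?T = "a ` (I - {r})"
    obtain p q where pq: "p \<in> span ?T" "\<And>w. w \<in> span ?T \<Longrightarrow> orthogonal q w" "a r = p + q"
      using orthogonal_subspace_decomp_exists by blast
    have T: "?T = a ` I - {a r}" using assms(1) r by (auto simp: inj_on_def)
    have "a r \<notin> span ?T"
      using assms(2) r unfolding T dependent_def by blast
    then have "q \<noteq> 0" using pq by auto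
    have "p \<in> span (a ` I)" using pq(1) span_mono[of ?T "a ` I"] by blast
    then have q: "q \<in> span (a ` I)"
      using span_diff[OF span_base[OF imageI[OF r]]] pq(3) by (metis add_diff_cancel_left')
    have "q \<bullet> p = 0" using pq(2)[OF pq(1)] by (simp add: orthogonal_def)
    then have qr: "q \<bullet> a r = q \<bullet> q" using pq(3) by (simp add: inner_add_right)
    have qs: "q \<bullet> a s = 0" if "s \<in> I" "s \<noteq> r" for s
      using pq(2)[OF span_base, of "a s"] that by (auto simp: orthogonal_def)
    show ?thesis
      using q qr qs \<open>q \<noteq> 0\<close>
      by (intro exI[of _ "(1 / (q \<bullet> q)) *\<^sub>R q"]) (auto intro: span_scale)
  qed
  then obtain w where "\<And>r. r \<in> I \<Longrightarrow> w r \<in> span (a ` I) \<and> (\<forall>s\<in>I. w r \<bullet> a s = (if r = s then 1 else 0))"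
    by metis
  with that show thesis by auto
qed

lemma span_finite_family:
  assumes "finite I" "inj_on a I" "u \<in> span (a ` I)"
  obtains c where "u = (\<Sum>r\<in>I. c r *\<^sub>R a r)"
proof -
  obtain f where "u = (\<Sum>v\<in>a ` I. f v *\<^sub>R v)"
    using assms(1,3) by (auto simp: span_finite)
  then have "u = (\<Sum>r\<in>I. f (a r) *\<^sub>R a r)"
    by (simp add: sum.reindex[OF assms(2)])
  then show thesis by (rule that)
qed

text \<open>
  The inverse is the Gram matrix \<open>W\<close> of the dual basis: its rows are the coefficients of the dual
  vectors, so \<open>W G\<close> is the duality relation, and symmetry of both matrices turns the left inverse
  into a right one.
\<close>

lemma gram_inverse_exists:
  fixes a :: "'r \<Rightarrow> 'a::euclidean_space"
  assumes "finite I" "inj_on a I" "independent (a ` I)"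
    and G: "\<And>r s. r \<in> I \<Longrightarrow> s \<in> I \<Longrightarrow> G r s = a r \<bullet> a s"
  shows "minvertible I G"
proof -
  obtain w where w: "\<And>r. r \<in> I \<Longrightarrow> w r \<in> span (a ` I)"
    "\<And>r s. r \<in> I \<Longrightarrow> s \<in> I \<Longrightarrow> w r \<bullet> a s = (if r = s then 1 else 0)"
    using dual_basis_exists[OF assms(2,3)] by metis
  have "\<exists>c. w r = (\<Sum>s\<in>I. c s *\<^sub>R a s)" if "r \<in> I" for r
    using span_finite_family[OF assms(1,2) w(1)[OF that]] by metis
  then obtain W where W: "\<And>r. r \<in> I \<Longrightarrow> w r = (\<Sum>s\<in>I. W r s *\<^sub>R a s)" by metis
  have W_dual: "W r s = w r \<bullet> w s" if "r \<in> I" "s \<in> I" for r s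
  proof -
    have "w r \<bullet> w s = (\<Sum>t\<in>I. W r t * (a t \<bullet> w s))"
      by (simp add: W[OF that(1)] inner_sum_left)
    also have "\<dots> = (\<Sum>t\<in>I. if t = s then W r t else 0)"
      using w(2) that by (intro sum.cong) (auto simp: inner_commute)
    finally show ?thesis using assms(1) that by simp
  qed
  have left: "(\<Sum>t\<in>I. W r t * G t s) = (if r = s then 1 else 0)" if "r \<in> I" "s \<in> I" for r s
  proof -
    have "(\<Sum>t\<in>I. W r t * G t s) = w r \<bullet> a s"
      using that by (simp add: W[OF that(1)] inner_sum_left G)
    with w(2) that show ?thesis by simp
  qed
  have right: "(\<Sum>t\<in>I. G r t * W t s) = (if r = s then 1 else 0)" if "r \<in> I" "s \<in> I" for r s
  proof -
    have "(\<Sum>t\<in>I. G r t * W t s) = (\<Sum>t\<in>I. W s t * G t r)"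
      using that by (intro sum.cong) (auto simp: W_dual G inner_commute)
    with left[OF that(2,1)] show ?thesis by auto
  qed
  show ?thesis
    unfolding minvertible_def is_minv_def mprod_def
    using left right by blast
qed

lemma expansion_by_gram_inverse:
  fixes a :: "'r \<Rightarrow> 'a::euclidean_space"
  assumes "finite I" "inj_on a I" "u \<in> span (a ` I)"
    and G: "\<And>r s. r \<in> I \<Longrightarrow> s \<in> I \<Longrightarrow> G r s = a r \<bullet> a s"
    and W: "is_minv I G W"
  shows "u = (\<Sum>r\<in>I. (\<Sum>s\<in>I. W r s * (a s \<bullet> u)) *\<^sub>R a r)"
proof -
  obtain c where c: "u = (\<Sum>r\<in>I. c r *\<^sub>R a r)"
    using span_finite_family[OF assms(1-3)] .
  have "(\<Sum>s\<in>I. W r s * (a s \<bullet> u)) = c r" if r: "r \<in> I" for r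
  proof -
    have "(\<Sum>s\<in>I. W r s * (a s \<bullet> u)) = (\<Sum>s\<in>I. \<Sum>t\<in>I. W r s * G s t * c t)"
      by (intro sum.cong refl) (simp add: c inner_sum_right sum_distrib_left G mult_ac)
    also have "\<dots> = (\<Sum>t\<in>I. (\<Sum>s\<in>I. W r s * G s t) * c t)"
      by (subst sum.swap) (simp add: sum_distrib_right)
    also have "\<dots> = (\<Sum>t\<in>I. if r = t then c t else 0)"
      using W r by (intro sum.cong refl) (simp add: is_minv_def mprod_def)
    finally show ?thesis using assms(1) r by simp
  qed
  then show ?thesis by (simp add: c[symmetric])
qed

section \<open>The penalized problem as a projection\<close>

text \<open>
  The rows of the scaled system \<open>[B, A / \<surd>\<lambda>]\<close>. In the coordinates \<open>(\<theta>, \<surd>\<lambda> \<xi>)\<close> the objective is half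
  the squared distance to \<open>(y, 0)\<close>, and the matrix \<open>B B\<^sup>T + A A\<^sup>T / \<lambda>\<close> is
  the Gram matrix of these rows.
\<close>

definition constraint_row ::
  "('n::finite \<Rightarrow> real ^ 'd::finite) \<Rightarrow> real \<Rightarrow> 'n \<times> 'n \<Rightarrow> (real ^ 'n) \<times> (real ^ 'd ^ 'n)" where
  "constraint_row x lam r = ((\<chi> c. B_mat r c), (\<chi> j l. A_mat x r (j, l) / sqrt lam))"

definition off_diagonal :: "('n \<times> 'n) set" where
  "off_diagonal = {(j, k). j \<noteq> k}"

abbreviation constraint_cone ::
  "('n::finite \<Rightarrow> real ^ 'd::finite) \<Rightarrow> real \<Rightarrow> ((real ^ 'n) \<times> (real ^ 'd ^ 'n)) set" where
  "constraint_cone x lam \<equiv> polyhedral_cone (constraint_row x lam) off_diagonal"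

definition scaled_solution ::
  "('n::finite \<Rightarrow> real ^ 'd::finite) \<Rightarrow> real \<Rightarrow> real ^ 'n \<Rightarrow> (real ^ 'n) \<times> (real ^ 'd ^ 'n)" where
  "scaled_solution x lam y = closest_point (constraint_cone x lam) (y, 0)"

lemma inner_constraint_row:
  fixes x :: "'n::finite \<Rightarrow> real ^ 'd::finite"
  assumes "j \<noteq> k" "lam > 0"
  shows "constraint_row x lam (j, k) \<bullet> (\<theta>, sqrt lam *\<^sub>R \<xi>) =
    (\<xi> $ j) \<bullet> (x k - x j) - (\<theta> $ k - \<theta> $ j)"
proof -
  have "(\<chi> c. B_mat (j, k) c) \<bullet> \<theta> =
      (\<Sum>c\<in>UNIV. (if c = j then \<theta> $ c else 0) - (if c = k then \<theta> $ c else 0))"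
    using assms(1) unfolding inner_vec_def by (intro sum.cong) (auto simp: B_mat_def)
  then have B: "(\<chi> c. B_mat (j, k) c) \<bullet> \<theta> = \<theta> $ j - \<theta> $ k"
    by (simp add: sum_subtractf)
  have "(\<chi> j' l. A_mat x (j, k) (j', l) / sqrt lam) \<bullet> (sqrt lam *\<^sub>R \<xi>) =
      (\<Sum>j'\<in>UNIV. if j' = j then (\<Sum>l\<in>UNIV. (x k - x j) $ l * \<xi> $ j' $ l) else 0)"
    using assms(2) unfolding inner_vec_def by (intro sum.cong) (auto simp: A_mat_def)
  also have "\<dots> = (\<xi> $ j) \<bullet> (x k - x j)"
    by (simp add: inner_vec_def mult.commute)
  finally show ?thesis using B by (simp add: constraint_row_def)
qed

lemma pcls_feasible_iff_constraint_cone: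
  assumes "lam > 0"
  shows "pcls_feasible x (\<theta>, \<xi>) \<longleftrightarrow> (\<theta>, sqrt lam *\<^sub>R \<xi>) \<in> constraint_cone x lam"
  using assms
  by (fastforce simp: pcls_feasible_def polyhedral_cone_def off_diagonal_def inner_constraint_row)

lemma pcls_objective_eq_dist:
  assumes "lam > 0"
  shows "pcls_objective lam y (\<theta>, \<xi>) = 1 / 2 * (dist (y, 0) (\<theta>, sqrt lam *\<^sub>R \<xi>))\<^sup>2"
proof -
  have "(norm (sqrt lam *\<^sub>R \<xi>))\<^sup>2 = lam * (norm \<xi>)\<^sup>2"
    using assms by (simp add: power_mult_distrib)
  also have "(norm \<xi>)\<^sup>2 = (\<Sum>j\<in>UNIV. (norm (\<xi> $ j))\<^sup>2)"
    by (simp add: norm_vec_def L2_set_def sum_nonneg)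
  finally have norm_\<xi>: "(norm (sqrt lam *\<^sub>R \<xi>))\<^sup>2 = lam * (\<Sum>j\<in>UNIV. (norm (\<xi> $ j))\<^sup>2)" .
  have "(dist (y, 0) (\<theta>, sqrt lam *\<^sub>R \<xi>))\<^sup>2 = (dist y \<theta>)\<^sup>2 + (dist 0 (sqrt lam *\<^sub>R \<xi>))\<^sup>2"
    by (simp only: dist_Pair_Pair) simp
  then show ?thesis
    using norm_\<xi> by (simp only: dist_0_norm) (simp add: pcls_objective_def dist_norm norm_minus_commute)
qed

text \<open>
  Minimizers of the objective over the feasible set correspond under \<open>(\<theta>, \<xi>) \<mapsto> (\<theta>, \<surd>\<lambda> \<xi>)\<close> to points of the
  closed convex cone nearest to \<open>(y, 0)\<close>. The latter exist and are unique, so the choice made by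
  \<open>arg_min\<close> is forced.
\<close>

lemma scaled_solution_eq:
  fixes x :: "'n::finite \<Rightarrow> real ^ 'd::finite"
  assumes lam: "lam > 0"
  shows "scaled_solution x lam y = (theta_hat x lam y, sqrt lam *\<^sub>R xi_hat x lam y)"
proof -
  let ?C = "constraint_cone x lam" and ?z = "scaled_solution x lam y"
  let ?p = "(fst ?z, (1 / sqrt lam) *\<^sub>R snd ?z)"
  note C = closed_polyhedral_cone[of "constraint_row x lam" off_diagonal]
    convex_polyhedral_cone[of "constraint_row x lam" off_diagonal]
  have ne: "?C \<noteq> {}" using zero_in_polyhedral_cone by blast
  have z: "?z \<in> ?C" "\<forall>w\<in>?C. dist (y, 0) ?z \<le> dist (y, 0) w"
    using closest_point_exists[OF C(1) ne] unfolding scaled_solution_def by auto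
  have scale: "(fst ?p, sqrt lam *\<^sub>R snd ?p) = ?z" using lam by simp
  have "is_arg_min (pcls_objective lam y) (pcls_feasible x) ?p"
    unfolding is_arg_min_linorder
  proof safe
    show "pcls_feasible x ?p"
      using z(1) scale lam by (simp add: pcls_feasible_iff_constraint_cone)
    fix \<theta> \<xi> assume "pcls_feasible x (\<theta>, \<xi>)"
    then have "dist (y, 0) ?z \<le> dist (y, 0) (\<theta>, sqrt lam *\<^sub>R \<xi>)"
      using z(2) lam by (simp add: pcls_feasible_iff_constraint_cone)
    then show "pcls_objective lam y ?p \<le> pcls_objective lam y (\<theta>, \<xi>)"
      using scale lam by (simp add: pcls_objective_eq_dist power_mono)
  qed
  then have "is_arg_min (pcls_objective lam y) (pcls_feasible x) (pcls_solution x lam y)"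
    unfolding pcls_solution_def arg_min_def by (rule someI)
  moreover obtain \<theta> \<xi> where p: "pcls_solution x lam y = (\<theta>, \<xi>)" by fastforce
  ultimately have feas: "pcls_feasible x (\<theta>, \<xi>)"
    and le: "pcls_objective lam y (\<theta>, \<xi>) \<le> pcls_objective lam y ?p"
    using \<open>is_arg_min (pcls_objective lam y) (pcls_feasible x) ?p\<close>
    by (auto simp: is_arg_min_linorder)
  have in_C: "(\<theta>, sqrt lam *\<^sub>R \<xi>) \<in> ?C"
    using feas lam by (simp add: pcls_feasible_iff_constraint_cone)
  have "(dist (y, 0) (\<theta>, sqrt lam *\<^sub>R \<xi>))\<^sup>2 \<le> (dist (y, 0) ?z)\<^sup>2"
    using le scale lam by (simp add: pcls_objective_eq_dist)
  then have "dist (y, 0) (\<theta>, sqrt lam *\<^sub>R \<xi>) \<le> dist (y, 0) ?z"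
    by (simp add: power2_le_iff_abs_le)
  then have "(\<theta>, sqrt lam *\<^sub>R \<xi>) = ?z"
    using closest_point_unique[OF C(2,1) in_C, of "(y, 0)"] z(2)
    unfolding scaled_solution_def by fastforce
  with p show ?thesis by (simp add: theta_hat_def xi_hat_def)
qed

lemma active_set_eq:
  fixes x :: "'n::finite \<Rightarrow> real ^ 'd::finite"
  assumes "lam > 0"
  shows "active_set x lam y = active_rows (constraint_row x lam) off_diagonal (scaled_solution x lam y)"
  unfolding scaled_solution_eq[OF assms]
  using assms
  by (auto simp: active_set_def active_rows_def off_diagonal_def inner_constraint_row)

lemma theta_hat_lipschitz:
  fixes x :: "'n::finite \<Rightarrow> real ^ 'd::finite"
  assumes "lam > 0"
  shows "norm (theta_hat x lam y - theta_hat x lam y') \<le> norm (y - y')"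
proof -
  have "constraint_cone x lam \<noteq> {}" using zero_in_polyhedral_cone by blast
  then have "dist (scaled_solution x lam y) (scaled_solution x lam y') \<le> dist (y, 0::real^'d^'n) (y', 0)"
    unfolding scaled_solution_def
    by (intro closest_point_lipschitz convex_polyhedral_cone closed_polyhedral_cone)
  moreover have "dist (theta_hat x lam y) (theta_hat x lam y')
      \<le> dist (scaled_solution x lam y) (scaled_solution x lam y')"
    unfolding scaled_solution_eq[OF assms] by (metis dist_fst_le fst_conv)
  ultimately show ?thesis by (simp add: dist_Pair_Pair dist_norm)
qed

lemma gram_mat_eq_inner:
  fixes x :: "'n::finite \<Rightarrow> real ^ 'd::finite"
  assumes "lam > 0"
  shows "gram_mat x lam r s = constraint_row x lam r \<bullet> constraint_row x lam s"
proof -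
  have "(\<Sum>p\<in>UNIV. A_mat x r p * A_mat x s p) = (\<Sum>j\<in>UNIV. \<Sum>l\<in>UNIV. A_mat x r (j, l) * A_mat x s (j, l))"
    by (simp add: sum.cartesian_product)
  then have A: "1 / lam * (\<Sum>p\<in>UNIV. A_mat x r p * A_mat x s p) =
      (\<Sum>j\<in>UNIV. \<Sum>l\<in>UNIV. A_mat x r (j, l) * A_mat x s (j, l) / lam)"
    by (simp add: sum_divide_distrib)
  have "(\<Sum>p\<in>UNIV. A_mat x r p * A_mat x s p) / lam =
      (\<Sum>j\<in>UNIV. \<Sum>l\<in>UNIV. (A_mat x r (j, l) / sqrt lam) * (A_mat x s (j, l) / sqrt lam))"
    using A assms by simp
  then show ?thesis
    by (simp add: gram_mat_def mprod_def mtransp_def constraint_row_def inner_vec_def)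
qed

text \<open>
  The rows of \<open>[A, B]\<close> and the scaled rows differ by an injective linear map, which rescales the
  coordinates of \<open>A\<close> by \<open>1 / \<surd>\<lambda>\<close> and regroups them.
\<close>

lemma indep_rows_iff_constraint_rows:
  fixes x :: "'n::finite \<Rightarrow> real ^ 'd::finite"
  assumes "lam > 0"
  shows "indep_rows (mappend (A_mat x) B_mat) I \<longleftrightarrow>
    inj_on (constraint_row x lam) I \<and> independent (constraint_row x lam ` I)"
proof -
  define T :: "real ^ ('n \<times> 'd + 'n) \<Rightarrow> (real ^ 'n) \<times> (real ^ 'd ^ 'n)"
    where "T v = ((\<chi> c. v $ Inr c), (\<chi> j l. v $ Inl (j, l) / sqrt lam))" for v
  have "linear T"
    by (rule linearI) (auto simp: T_def vec_eq_iff add_divide_distrib)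
  have "inj T"
  proof (rule injI)
    fix u v assume "T u = T v"
    then have "u $ Inr c = v $ Inr c" "u $ Inl (j, l) = v $ Inl (j, l)" for c j l
      using assms by (auto simp: T_def vec_eq_iff)
    then show "u = v"
      unfolding vec_eq_iff by (metis sum.exhaust surj_pair)
  qed
  have T: "constraint_row x lam = T \<circ> mrow (mappend (A_mat x) B_mat)"
    by (auto simp: fun_eq_iff constraint_row_def T_def mrow_def mappend_def)
  have "independent (T ` S) \<longleftrightarrow> independent S" for S
  proof
    assume ind: "independent (T ` S)"
    have "v \<notin> span (S - {v})" if "v \<in> S" for v
    proof
      assume "v \<in> span (S - {v})"
      then have "T v \<in> span (T ` (S - {v}))"
        using \<open>linear T\<close> by (simp add: linear_span_image)
      also have "T ` (S - {v}) = T ` S - {T v}"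
        using \<open>inj T\<close> by (auto simp: inj_def)
      finally show False
        using ind that by (auto simp: dependent_def)
    qed
    then show "independent S" by (auto simp: dependent_def)
  next
    assume "independent S"
    then show "independent (T ` S)"
      using \<open>linear T\<close> \<open>inj T\<close> linear_independent_injective_image inj_on_subset by blast
  qed
  moreover have "inj_on (T \<circ> m) I \<longleftrightarrow> inj_on m I" for m :: "'n \<times> 'n \<Rightarrow> _"
    by (simp add: inj_on_def inj_eq[OF \<open>inj T\<close>])
  ultimately show ?thesis
    unfolding indep_rows_def T image_comp[symmetric] by simp
qed

section \<open>The divergence formula\<close>

lemma exists_max_indep_rows:
  fixes J :: "('n::finite \<times> 'n) set"
  shows "\<exists>I. max_indep_rows M J I"
proof -
  let ?\<I> = "{I. I \<subseteq> J \<and> indep_rows M I}"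
  have ne: "?\<I> \<noteq> {}"
    using independent_empty by (auto simp: indep_rows_def intro!: exI[of _ "{}"])
  have "\<exists>I\<in>?\<I>. \<forall>I'\<in>?\<I>. I \<subseteq> I' \<longrightarrow> I = I'"
    by (rule finite_has_maximal[OF finite ne])
  then obtain I where "I \<in> ?\<I> \<and> (\<forall>I'\<in>?\<I>. I \<subseteq> I' \<longrightarrow> I = I')"
    by (elim bexE) (rule that, rule conjI)
  then show ?thesis
    unfolding max_indep_rows_def by (intro exI[of _ I]) (metis (lifting) mem_Collect_eq psubsetE)
qed

lemma span_max_indep_rows:
  fixes x :: "'n::finite \<Rightarrow> real ^ 'd::finite"
  assumes "lam > 0" and I: "max_indep_rows (mappend (A_mat x) B_mat) J I"
  shows "span (constraint_row x lam ` J) = span (constraint_row x lam ` I)"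
proof
  let ?a = "constraint_row x lam"
  note indep = indep_rows_iff_constraint_rows[OF assms(1)]
  have sub: "I \<subseteq> J" and ind: "inj_on ?a I" "independent (?a ` I)"
    using I unfolding max_indep_rows_def indep by - (elim conjE, assumption)+
  have max: "\<not> (inj_on ?a I' \<and> independent (?a ` I'))" if "I \<subset> I'" "I' \<subseteq> J" for I'
  proof -
    have "\<forall>I'. I \<subset> I' \<and> I' \<subseteq> J \<longrightarrow> \<not> indep_rows (mappend (A_mat x) B_mat) I'"
      using I unfolding max_indep_rows_def by (elim conjE)
    then have "\<not> indep_rows (mappend (A_mat x) B_mat) I'"
      using that by (elim allE[of _ I'] impE) (rule conjI)
    then show ?thesis unfolding indep .
  qed
  have "?a r \<in> span (?a ` I)" if r: "r \<in> J" for r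
  proof (rule ccontr)
    assume not: "?a r \<notin> span (?a ` I)"
    then have new: "?a r \<notin> ?a ` I" by (rule contrapos_nn) (rule span_base)
    then have "r \<notin> I" by (rule contrapos_nn) (rule imageI)
    then have "I \<subset> insert r I" by (simp add: psubset_insert_iff)
    moreover have "inj_on ?a (insert r I)"
      using new ind(1) \<open>r \<notin> I\<close> by simp
    moreover have "independent (?a ` insert r I)"
      using not ind(2) by (simp add: independent_insertI)
    ultimately show False using max[of "insert r I"] r sub by simp
  qed
  then show "span (?a ` J) \<subseteq> span (?a ` I)"
    by (intro span_minimal) auto
  show "span (?a ` I) \<subseteq> span (?a ` J)"
    using sub by (intro span_mono image_mono)
qed

lemma minvertible_gram_mat:
  fixes x :: "'n::finite \<Rightarrow> real ^ 'd::finite"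
  assumes "lam > 0" and "indep_rows (mappend (A_mat x) B_mat) I"
  shows "minvertible I (gram_mat x lam)"
proof (rule gram_inverse_exists[of I "constraint_row x lam"])
  show "inj_on (constraint_row x lam) I" "independent (constraint_row x lam ` I)"
    using assms indep_rows_iff_constraint_rows[OF assms(1)] by blast+
qed (simp_all add: gram_mat_eq_inner[OF assms(1)])

text \<open>
  The residual \<open>u = (y, 0) - z\<close> lies in the span of the rows in \<open>I\<close>, and \<open>z\<close> is orthogonal to
  these rows because they are active. So the inner products of \<open>u\<close> with the rows are the entries of
  \<open>B y\<close>, and the Gram inverse turns them into the coefficients of \<open>u\<close>. The resulting
  expression is linear in \<open>y\<close> as long as \<open>I\<close> stays the same.
\<close>

lemma theta_hat_eq_projection:
  fixes x :: "'n::finite \<Rightarrow> real ^ 'd::finite"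
  assumes lam: "lam > 0" and I: "max_indep_rows (mappend (A_mat x) B_mat) (active_set x lam y) I"
    and W: "is_minv I (gram_mat x lam) W"
  shows "theta_hat x lam y $ c =
    y $ c - (\<Sum>r\<in>I. (\<Sum>s\<in>I. W r s * (\<Sum>k\<in>UNIV. B_mat s k * y $ k)) * B_mat r c)"
proof -
  let ?a = "constraint_row x lam" and ?z = "scaled_solution x lam y"
  define u where "u = (y, 0) - ?z"
  have "u \<in> span (?a ` active_set x lam y)"
    unfolding u_def active_set_eq[OF lam]
    by (rule residual_in_span_active_rows) (auto simp: scaled_solution_def)
  then have u: "u \<in> span (?a ` I)"
    using span_max_indep_rows[OF lam I] by simp
  have inj: "inj_on ?a I"
    using I by (simp add: max_indep_rows_def indep_rows_iff_constraint_rows[OF lam])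
  have "?a s \<bullet> u = (\<Sum>k\<in>UNIV. B_mat s k * y $ k)" if "s \<in> I" for s
  proof -
    have "s \<in> active_rows ?a off_diagonal ?z"
      using that I active_set_eq[OF lam] by (auto simp: max_indep_rows_def)
    then have "?a s \<bullet> u = ?a s \<bullet> (y, 0)"
      by (simp add: u_def active_rows_def inner_diff_right)
    then show ?thesis by (simp add: constraint_row_def inner_vec_def)
  qed
  then have "u = (\<Sum>r\<in>I. (\<Sum>s\<in>I. W r s * (\<Sum>k\<in>UNIV. B_mat s k * y $ k)) *\<^sub>R ?a r)"
    using expansion_by_gram_inverse[OF _ inj u gram_mat_eq_inner[OF lam] W] by simp
  then have "fst u $ c = (\<Sum>r\<in>I. (\<Sum>s\<in>I. W r s * (\<Sum>k\<in>UNIV. B_mat s k * y $ k)) * B_mat r c)"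
    by (simp add: fst_sum constraint_row_def)
  moreover have "fst u $ c = y $ c - theta_hat x lam y $ c"
    by (simp add: u_def scaled_solution_eq[OF lam])
  ultimately show ?thesis by simp
qed

text \<open>
  On the interior of a piece the index set \<open>I\<close> and the matrix \<open>W\<close> may be kept fixed, so
  that near \<open>y\<close> the estimator is the linear map \<open>1 - B\<^sub>I\<^sup>T W B\<^sub>I\<close>.
\<close>

lemma coord_line_has_derivative:
  fixes x :: "'n::finite \<Rightarrow> real ^ 'd::finite"
  assumes lam: "lam > 0" and I: "max_indep_rows (mappend (A_mat x) B_mat) J I"
    and W: "is_minv I (gram_mat x lam) W"
    and y: "y \<in> interior {y'. active_set x lam y' = J}"
  shows "(coord_line (theta_hat x lam) y i has_field_derivative
    (1 - mprod I (mprod I (mtransp B_mat) W) B_mat i i)) (at 0)"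
proof -
  let ?L = "\<lambda>v. v $ i - (\<Sum>r\<in>I. (\<Sum>s\<in>I. W r s * (\<Sum>k\<in>UNIV. B_mat s k * v $ k)) * B_mat r i)"
  have "((\<lambda>t. y + t *\<^sub>R axis i 1) \<longlongrightarrow> y + 0 *\<^sub>R axis i 1) (nhds (0::real))"
    by (intro tendsto_intros filterlim_ident)
  then have "\<forall>\<^sub>F t in nhds (0::real). y + t *\<^sub>R axis i 1 \<in> interior {y'. active_set x lam y' = J}"
    by (rule topological_tendstoD) (use y in auto)
  then have ev: "\<forall>\<^sub>F t in nhds (0::real). coord_line (theta_hat x lam) y i t = ?L (y + t *\<^sub>R axis i 1)"
  proof eventually_elim
    case (elim t)
    then have "active_set x lam (y + t *\<^sub>R axis i 1) = J"
      using interior_subset by blast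
    with theta_hat_eq_projection[OF lam _ W, of "y + t *\<^sub>R axis i 1" i] I show ?case
      by (simp add: coord_line_def)
  qed
  have "((\<lambda>t. ?L (y + t *\<^sub>R axis i 1)) has_field_derivative ?L (axis i 1)) (at 0)"
    by (auto intro!: derivative_eq_intros) (simp add: mult_ac)
  moreover have "?L (axis i 1) = 1 - mprod I (mprod I (mtransp B_mat) W) B_mat i i"
  proof -
    have B: "(\<Sum>k\<in>UNIV. B_mat s k * axis i 1 $ k) = B_mat s i" for s :: "'n \<times> 'n"
    proof -
      have "(\<Sum>k\<in>UNIV. B_mat s k * axis i 1 $ k) = (\<Sum>k\<in>UNIV. if k = i then B_mat s k else 0)"
        by (intro sum.cong) (auto simp: axis_def)
      then show ?thesis by simp
    qed
    have "(\<Sum>r\<in>I. (\<Sum>s\<in>I. W r s * B_mat s i) * B_mat r i)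
        = (\<Sum>s\<in>I. (\<Sum>r\<in>I. B_mat r i * W r s) * B_mat s i)"
      unfolding sum_distrib_right by (subst sum.swap) (simp add: mult_ac)
    then show ?thesis
      unfolding B by (simp add: mprod_def mtransp_def axis_def)
  qed
  ultimately have "((\<lambda>t. ?L (y + t *\<^sub>R axis i 1)) has_field_derivative
      (1 - mprod I (mprod I (mtransp B_mat) W) B_mat i i)) (at 0)"
    by simp
  then show ?thesis
    using DERIV_cong_ev[OF refl ev refl] by blast
qed

lemma AE_interior_active_set:
  fixes x :: "'n::finite \<Rightarrow> real ^ 'd::finite"
  assumes lam: "lam > 0"
  shows "AE y in lborel. y \<in> interior {y'. active_set x lam y' = active_set x lam y}"
proof -
  let ?S = "\<lambda>J. {y'. active_set x lam y' = J}"
  have "convex (?S J)" for J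
  proof -
    let ?V = "{v. active_rows (constraint_row x lam) off_diagonal
      (closest_point (constraint_cone x lam) v) = J}"
    have "?S J = (\<lambda>y. (y, 0)) -` ?V"
      by (auto simp: active_set_eq[OF lam] scaled_solution_def)
    moreover have "linear (\<lambda>y::real^'n. (y, 0::real^'d^'n))"
      by (rule linearI) auto
    ultimately show ?thesis
      using convex_linear_vimage convex_projection_piece[of off_diagonal "constraint_row x lam" J]
      by (metis finite_code)
  qed
  then have "AE y in lborel. \<exists>J\<in>UNIV. y \<in> interior (?S J)"
    by (intro AE_interior_of_finite_convex_cover) auto
  then show ?thesis
  proof eventually_elim
    case (elim y)
    then obtain J where J: "y \<in> interior (?S J)" by blast
    then have "active_set x lam y = J" using interior_subset by blast
    with J show ?case by simp
  qed
qed

lemma divergence_theta_hat: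
  fixes x :: "'n::finite \<Rightarrow> real ^ 'd::finite"
  assumes lam: "lam > 0" 
    and y: "y \<in> interior {y'. active_set x lam y' = active_set x lam y}"
    and I: "max_indep_rows (mappend (A_mat x) B_mat) (active_set x lam y) I"
  shows "divergence (theta_hat x lam) y = real CARD('n) - mtrace UNIV
           (mprod I (mprod I (mtransp B_mat) (minv I (gram_mat x lam))) B_mat)"
proof -
  have "minvertible I (gram_mat x lam)"
    using I lam minvertible_gram_mat by (auto simp: max_indep_rows_def)
  then have "is_minv I (gram_mat x lam) (minv I (gram_mat x lam))"
    unfolding minvertible_def minv_def by (rule someI_ex)
  from DERIV_imp_deriv[OF coord_line_has_derivative[OF lam I this y]]
  show ?thesis
    by (simp add: divergence_def mtrace_def sum_subtractf)
qed

section \<open>Measurability of a derivative\<close>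

lemma DERIV_imp_quotient_LIMSEQ:
  fixes F :: "real \<Rightarrow> real"
  assumes "(F has_field_derivative d) (at 0)"
  shows "(\<lambda>n. (F (1 / Suc n) - F 0) / (1 / Suc n)) \<longlonglongrightarrow> d"
proof -
  have "((\<lambda>h. (F h - F 0) / h) \<longlongrightarrow> d) (at 0)"
    using assms by (simp add: DERIV_def)
  moreover have "filterlim (\<lambda>n. 1 / real (Suc n)) (at 0) sequentially"
    using LIMSEQ_inverse_real_of_nat
    by (auto simp: filterlim_at inverse_eq_divide)
  ultimately show ?thesis
    by (rule filterlim_compose)
qed

text \<open>
  The only candidate \<open>D\<close> for the derivative is the limit along one fixed sequence, and by continuity it
  suffices to compare \<open>D\<close> with the difference quotients at rational increments. This expresses
  differentiability by countably many conditions.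
\<close>

lemma has_derivative_iff_rational_quotients:
  fixes F :: "real \<Rightarrow> real"
  assumes cont: "continuous_on UNIV F"
  defines "D \<equiv> lim (\<lambda>n. (F (1 / Suc n) - F 0) / (1 / Suc n))"
  shows "(F has_field_derivative d) (at 0) \<longleftrightarrow> d = D \<and>
    (\<forall>k::nat. \<exists>n::nat. \<forall>r::rat. r \<noteq> 0 \<and> \<bar>of_rat r\<bar> < 1 / real (Suc n) \<longrightarrow>
       \<bar>(F (of_rat r) - F 0) / of_rat r - D\<bar> \<le> 1 / real (Suc k))" (is "?der \<longleftrightarrow> _ \<and> ?cond")
proof
  assume der: ?der
  have D: "D = d"
    unfolding D_def by (rule limI[OF DERIV_imp_quotient_LIMSEQ[OF der]])
  have "((\<lambda>h. (F h - F 0) / h) \<longlongrightarrow> d) (at 0)"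
    using der by (simp add: DERIV_def)
  have ?cond
  proof
    fix k :: nat
    have "\<forall>\<^sub>F h in at 0. dist ((F h - F 0) / h) d < 1 / real (Suc k)"
      by (rule tendstoD[OF \<open>((\<lambda>h. (F h - F 0) / h) \<longlongrightarrow> d) (at 0)\<close>]) simp
    then obtain e where e: "e > 0" "\<And>h. h \<noteq> 0 \<Longrightarrow> \<bar>h\<bar> < e \<Longrightarrow> \<bar>(F h - F 0) / h - d\<bar> < 1 / real (Suc k)"
      by (auto simp: eventually_at dist_real_def)
    obtain n where "1 / real (Suc n) < e"
      using e(1) nat_approx_posE by blast
    with e(2) show "\<exists>n::nat. \<forall>r::rat. r \<noteq> 0 \<and> \<bar>of_rat r\<bar> < 1 / real (Suc n) \<longrightarrow>
       \<bar>(F (of_rat r) - F 0) / of_rat r - D\<bar> \<le> 1 / real (Suc k)"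
      unfolding D by (intro exI[of _ n]) (auto intro!: less_imp_le)
  qed
  with D show "d = D \<and> ?cond" by simp
next
  assume *: "d = D \<and> ?cond"
  have "((\<lambda>h. (F h - F 0) / h) \<longlongrightarrow> D) (at 0)"
  proof (rule tendstoI)
    fix e :: real assume "e > 0"
    then obtain k where k: "1 / real (Suc k) < e" using nat_approx_posE by blast
    obtain n where n: "\<And>r::rat. r \<noteq> 0 \<Longrightarrow> \<bar>of_rat r\<bar> < 1 / real (Suc n) \<Longrightarrow>
       \<bar>(F (of_rat r) - F 0) / of_rat r - D\<bar> \<le> 1 / real (Suc k)"
      using * by meson
    have "\<bar>(F h - F 0) / h - D\<bar> \<le> 1 / real (Suc k)" if h: "h \<noteq> 0" "\<bar>h\<bar> < 1 / real (Suc n)" for h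
    proof (rule ccontr)
      assume not: "\<not> \<bar>(F h - F 0) / h - D\<bar> \<le> 1 / real (Suc k)"
      have "(F \<longlongrightarrow> F h) (at h)"
        using cont by (simp add: continuous_on_eq_continuous_at isCont_def)
      then have "((\<lambda>s. \<bar>(F s - F 0) / s - D\<bar>) \<longlongrightarrow> \<bar>(F h - F 0) / h - D\<bar>) (at h)"
        using h(1) by (intro tendsto_intros)
      then have "\<forall>\<^sub>F s in at h. \<bar>(F s - F 0) / s - D\<bar> > 1 / real (Suc k)"
        using not by (intro order_tendstoD(1)) auto
      moreover have "\<forall>\<^sub>F s in at h. \<bar>s\<bar> < 1 / real (Suc n)"
        by (rule order_tendstoD(2)[OF _ h(2)]) (intro tendsto_intros)
      moreover have "\<forall>\<^sub>F s in at h. s \<noteq> 0"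
        by (rule tendsto_imp_eventually_ne[OF _ h(1)]) (intro tendsto_intros)
      ultimately have "\<forall>\<^sub>F s in at h. \<bar>(F s - F 0) / s - D\<bar> > 1 / real (Suc k)
          \<and> \<bar>s\<bar> < 1 / real (Suc n) \<and> s \<noteq> 0"
        by eventually_elim blast
      then obtain \<delta> where \<delta>: "\<delta> > 0" "\<And>s. s \<noteq> h \<Longrightarrow> \<bar>s - h\<bar> < \<delta> \<Longrightarrow>
          \<bar>(F s - F 0) / s - D\<bar> > 1 / real (Suc k) \<and> \<bar>s\<bar> < 1 / real (Suc n) \<and> s \<noteq> 0"
        by (auto simp: eventually_at dist_real_def)
      obtain r where "h < of_rat r" "of_rat r < h + \<delta>"
        using of_rat_dense[of h "h + \<delta>"] \<delta>(1) by auto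
      then have "\<bar>(F (of_rat r) - F 0) / of_rat r - D\<bar> > 1 / real (Suc k)"
        "\<bar>of_rat r\<bar> < 1 / real (Suc n)" "r \<noteq> 0"
        using \<delta>(2)[of "of_rat r"] by auto
      with n[of r] show False by simp
    qed
    with k show "\<forall>\<^sub>F h in at 0. dist ((F h - F 0) / h) D < e"
      unfolding eventually_at dist_real_def
      by (intro exI[of _ "1 / real (Suc n)"]) force
  qed
  with * show ?der by (simp add: DERIV_def)
qed

text \<open>
  Where the derivative does not exist, \<open>deriv\<close> has one and the same arbitrary value, so that
  it is Borel on the whole space and not merely up to a null set. This matters because the
  probability space need not be complete.
\<close>

lemma borel_measurable_deriv:
  fixes F :: "'a \<Rightarrow> real \<Rightarrow> real"
  assumes [measurable]: "\<And>t. (\<lambda>w. F w t) \<in> borel_measurable M"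
    and cont: "\<And>w. continuous_on UNIV (F w)"
  shows "(\<lambda>w. deriv (F w) 0) \<in> borel_measurable M"
proof -
  define D where "D w = lim (\<lambda>n. (F w (1 / Suc n) - F w 0) / (1 / Suc n))" for w
  define cond where "cond w \<longleftrightarrow>
    (\<forall>k::nat. \<exists>n::nat. \<forall>r::rat. r \<noteq> 0 \<and> \<bar>of_rat r\<bar> < 1 / real (Suc n) \<longrightarrow>
       \<bar>(F w (of_rat r) - F w 0) / of_rat r - D w\<bar> \<le> 1 / real (Suc k))" for w
  have iff: "(F w has_field_derivative d) (at 0) \<longleftrightarrow> d = D w \<and> cond w" for w d
    unfolding D_def cond_def by (rule has_derivative_iff_rational_quotients[OF cont])
  have "deriv (F w) 0 = (if cond w then D w else (SOME d. False))" for w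
    by (simp add: deriv_def iff)
  moreover have D[measurable]: "D \<in> borel_measurable M"
    unfolding D_def by measurable
  have [measurable]: "Measurable.pred M cond"
    unfolding cond_def by measurable
  ultimately show ?thesis by simp
qed

section \<open>The isotropic Gaussian density\<close>

definition iso_density :: "real \<Rightarrow> real ^ 'n::finite \<Rightarrow> real" where
  "iso_density \<sigma> e = (\<Prod>i\<in>UNIV. normal_density 0 \<sigma> (e $ i))"

lemma iso_density_nonneg: "0 \<le> iso_density \<sigma> e"
  by (simp add: iso_density_def prod_nonneg)

lemma borel_measurable_iso_density [measurable]: "iso_density \<sigma> \<in> borel_measurable borel"
  unfolding iso_density_def by measurable

lemma iso_density_shift:
  assumes "\<sigma> > 0"
  shows "iso_density \<sigma> (e - h *\<^sub>R axis i 1) = iso_density \<sigma> e * exp ((h * e $ i - h\<^sup>2 / 2) / \<sigma>\<^sup>2)"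
proof -
  have shift: "normal_density 0 \<sigma> (t - h) = normal_density 0 \<sigma> t * exp ((h * t - h\<^sup>2 / 2) / \<sigma>\<^sup>2)" for t
  proof -
    have "- (t - h)\<^sup>2 / (2 * \<sigma>\<^sup>2) = - t\<^sup>2 / (2 * \<sigma>\<^sup>2) + (h * t - h\<^sup>2 / 2) / \<sigma>\<^sup>2"
      using assms by (simp add: field_simps power2_eq_square)
    then show ?thesis
      by (simp add: normal_density_def exp_add[symmetric])
  qed
  have "iso_density \<sigma> (e - h *\<^sub>R axis i 1) = normal_density 0 \<sigma> (e $ i - h) *
      (\<Prod>j\<in>UNIV - {i}. normal_density 0 \<sigma> ((e - h *\<^sub>R axis i 1) $ j))"
    unfolding iso_density_def by (subst prod.remove[of _ i]) (auto simp: axis_def)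
  also have "(\<Prod>j\<in>UNIV - {i}. normal_density 0 \<sigma> ((e - h *\<^sub>R axis i 1) $ j))
      = (\<Prod>j\<in>UNIV - {i}. normal_density 0 \<sigma> (e $ j))"
    by (intro prod.cong) (auto simp: axis_def)
  also have "normal_density 0 \<sigma> (e $ i - h) * \<dots> = iso_density \<sigma> e * exp ((h * e $ i - h\<^sup>2 / 2) / \<sigma>\<^sup>2)"
    unfolding iso_density_def by (subst (2) prod.remove[of _ i]) (auto simp: shift)
  finally show ?thesis .
qed

lemma integrable_iso_density:
  assumes "\<sigma> > 0"
  shows "integrable lborel (iso_density \<sigma> :: real ^ 'n::finite \<Rightarrow> real)"
proof -
  have basis: "(\<Prod>b\<in>Basis. ennreal (normal_density 0 \<sigma> (e \<bullet> b))) = ennreal (iso_density \<sigma> e)"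
    for e :: "real ^ 'n"
  proof -
    have B: "(Basis :: (real ^ 'n) set) = range (\<lambda>i. axis i 1)"
      by (auto simp: Basis_vec_def)
    have inj: "inj (\<lambda>i::'n. axis i (1::real))"
      by (auto simp: inj_def axis_eq_axis)
    have "(\<Prod>b\<in>Basis. ennreal (normal_density 0 \<sigma> (e \<bullet> b))) =
        (\<Prod>i\<in>UNIV. ennreal (normal_density 0 \<sigma> (e \<bullet> axis i 1)))"
      unfolding B by (subst prod.reindex[OF inj]) simp
    also have "\<dots> = (\<Prod>i\<in>UNIV. ennreal (normal_density 0 \<sigma> (e $ i)))"
      by (simp add: inner_axis)
    also have "\<dots> = ennreal (iso_density \<sigma> e)"
      unfolding iso_density_def by (intro prod_ennreal) simp
    finally show ?thesis .
  qed
  have "(\<integral>\<^sup>+ t. ennreal (normal_density 0 \<sigma> t) \<partial>lborel) = 1"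
    using assms by (subst nn_integral_eq_integral) auto
  then have "(\<integral>\<^sup>+ e. ennreal (iso_density \<sigma> e) \<partial>(lborel :: (real ^ 'n) measure)) = 1"
    unfolding basis[symmetric] by (subst nn_integral_lborel_prod) auto
  then show ?thesis
    by (intro integrableI_nonneg) (auto simp: iso_density_nonneg)
qed

text \<open>
  Completing the square: \<open>b |t| \<le> t\<^sup>2 / (4 \<sigma>\<^sup>2) + b\<^sup>2 \<sigma>\<^sup>2\<close>, so that half of the exponent of the density
  absorbs an exponential weight, at the price of doubling the variance.
\<close>

lemma normal_density_times_exp_le:
  assumes "\<sigma> > 0"
  shows "normal_density 0 \<sigma> t * exp (b * \<bar>t\<bar>) \<le> sqrt 2 * exp (b\<^sup>2 * \<sigma>\<^sup>2) * normal_density 0 (sqrt 2 * \<sigma>) t"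
proof -
  have "0 \<le> (\<bar>t\<bar> / (2 * \<sigma>) - b * \<sigma>)\<^sup>2" by simp
  also have "\<dots> = t\<^sup>2 / (4 * \<sigma>\<^sup>2) - b * \<bar>t\<bar> + b\<^sup>2 * \<sigma>\<^sup>2"
    using assms by (simp add: power2_diff power_divide power_mult_distrib)
  finally have "b * \<bar>t\<bar> \<le> b\<^sup>2 * \<sigma>\<^sup>2 + t\<^sup>2 / (4 * \<sigma>\<^sup>2)" by simp
  moreover have "- t\<^sup>2 / (2 * \<sigma>\<^sup>2) = - 2 * (t\<^sup>2 / (4 * \<sigma>\<^sup>2))" by simp
  moreover have "- t\<^sup>2 / (2 * (sqrt 2 * \<sigma>)\<^sup>2) = - (t\<^sup>2 / (4 * \<sigma>\<^sup>2))"
    by (simp add: power_mult_distrib)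
  ultimately have "- t\<^sup>2 / (2 * \<sigma>\<^sup>2) + b * \<bar>t\<bar> \<le> b\<^sup>2 * \<sigma>\<^sup>2 + - t\<^sup>2 / (2 * (sqrt 2 * \<sigma>)\<^sup>2)"
    by linarith
  then have "exp (- t\<^sup>2 / (2 * \<sigma>\<^sup>2)) * exp (b * \<bar>t\<bar>) \<le>
      exp (b\<^sup>2 * \<sigma>\<^sup>2) * exp (- t\<^sup>2 / (2 * (sqrt 2 * \<sigma>)\<^sup>2))"
    by (simp only: exp_add[symmetric] exp_le_cancel_iff)
  moreover have "sqrt (2 * pi * (sqrt 2 * \<sigma>)\<^sup>2) = sqrt 2 * sqrt (2 * pi * \<sigma>\<^sup>2)"
    by (simp add: power_mult_distrib real_sqrt_mult)
  ultimately show ?thesis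
    using assms by (simp add: normal_density_def divide_right_mono)
qed

lemma integrable_iso_density_exp:
  assumes "\<sigma> > 0"
  shows "integrable lborel (\<lambda>e::real ^ 'n::finite. iso_density \<sigma> e * exp (b * (\<Sum>j\<in>UNIV. \<bar>e $ j\<bar>)))"
proof -
  define K where "K = sqrt 2 * exp (b\<^sup>2 * \<sigma>\<^sup>2)"
  have bound: "iso_density \<sigma> e * exp (b * (\<Sum>j\<in>UNIV. \<bar>e $ j\<bar>)) \<le>
      K ^ CARD('n) * iso_density (sqrt 2 * \<sigma>) e" for e :: "real ^ 'n"
  proof -
    have "iso_density \<sigma> e * exp (b * (\<Sum>j\<in>UNIV. \<bar>e $ j\<bar>)) =
        (\<Prod>j\<in>UNIV. normal_density 0 \<sigma> (e $ j) * exp (b * \<bar>e $ j\<bar>))"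
      by (simp add: iso_density_def prod.distrib sum_distrib_left exp_sum)
    also have "\<dots> \<le> (\<Prod>j\<in>UNIV. K * normal_density 0 (sqrt 2 * \<sigma>) (e $ j))"
      unfolding K_def using normal_density_times_exp_le[OF assms] by (intro prod_mono) auto
    finally show ?thesis by (simp add: iso_density_def prod.distrib)
  qed
  have "integrable lborel (\<lambda>e::real ^ 'n. K ^ CARD('n) * iso_density (sqrt 2 * \<sigma>) e)"
    using assms by (intro integrable_mult_right integrable_iso_density) simp
  then show ?thesis
    by (rule Bochner_Integration.integrable_bound)
      (auto simp: iso_density_nonneg intro!: order_trans[OF bound])
qed

text \<open>
  A growth condition in terms of \<open>exp (b \<parallel>e\<parallel>\<^sub>1)\<close> covers polynomial growth and the density ratios of
  shifted Gaussians at the same time, and the weight splits into a product over the coordinates.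
\<close>

lemma integrable_iso_density_times:
  fixes h :: "real ^ 'n::finite \<Rightarrow> real"
  assumes "\<sigma> > 0" and [measurable]: "h \<in> borel_measurable borel"
    and bound: "\<And>e. \<bar>h e\<bar> \<le> C * exp (b * (\<Sum>j\<in>UNIV. \<bar>e $ j\<bar>))"
  shows "integrable lborel (\<lambda>e. iso_density \<sigma> e * h e)"
proof -
  have "integrable lborel (\<lambda>e::real ^ 'n. C * (iso_density \<sigma> e * exp (b * (\<Sum>j\<in>UNIV. \<bar>e $ j\<bar>))))"
    by (intro integrable_mult_right integrable_iso_density_exp assms(1))
  then show ?thesis
  proof (rule Bochner_Integration.integrable_bound)
    have "norm (iso_density \<sigma> e * h e) \<le> norm (C * (iso_density \<sigma> e * exp (b * (\<Sum>j\<in>UNIV. \<bar>e $ j\<bar>))))" for e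
    proof -
      have "norm (iso_density \<sigma> e * h e) = iso_density \<sigma> e * \<bar>h e\<bar>"
        by (simp add: abs_mult iso_density_nonneg)
      also have "\<dots> \<le> iso_density \<sigma> e * (C * exp (b * (\<Sum>j\<in>UNIV. \<bar>e $ j\<bar>)))"
        by (rule mult_left_mono[OF bound iso_density_nonneg])
      finally show ?thesis by (simp add: mult_ac) 
    qed
    then show "AE e in lborel. norm (iso_density \<sigma> e * h e) \<le>
        norm (C * (iso_density \<sigma> e * exp (b * (\<Sum>j\<in>UNIV. \<bar>e $ j\<bar>))))"
      by simp
  qed simp
qed

section \<open>Stein's identity for Lipschitz functions\<close>

lemma abs_exp_minus_one_le: "\<bar>exp u - 1\<bar> \<le> \<bar>u\<bar> * exp \<bar>u\<bar>" for u :: real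
proof (cases "u \<ge> 0")
  case True
  have "exp u * (1 - u) \<le> exp u * exp (- u)"
    using exp_ge_add_one_self[of "- u"] by (intro mult_left_mono) auto
  then have "exp u - u * exp u \<le> 1"
    by (simp add: exp_minus algebra_simps)
  with True show ?thesis by simp
next
  case False
  then have "\<bar>exp u - 1\<bar> \<le> \<bar>u\<bar>"
    using exp_ge_add_one_self[of u] unfolding abs_if by (auto simp: algebra_simps)
  also have "\<dots> \<le> \<bar>u\<bar> * exp \<bar>u\<bar>"
    using one_le_exp_iff[of "\<bar>u\<bar>"] by (simp add: mult_le_cancel_left1 del: one_le_exp_iff)
  finally show ?thesis .
qed

text \<open>
  The ratio of the shifted density to the density is \<open>exp ((h t - h\<^sup>2 / 2) / \<sigma>\<^sup>2)\<close>. The bound on its difference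
  quotients does not depend on \<open>h\<close>, as dominated convergence requires.
\<close>

lemma tilt_quotient_bound:
  fixes \<sigma> h t N :: real
  assumes "\<sigma> > 0" "0 < h" "h \<le> 1" "\<bar>t\<bar> \<le> N"
  shows "\<bar>(exp ((h * t - h\<^sup>2 / 2) / \<sigma>\<^sup>2) - 1) / h\<bar> \<le> exp (1 / \<sigma>\<^sup>2) / \<sigma>\<^sup>2 * exp ((1 + 1 / \<sigma>\<^sup>2) * N)"
proof -
  define u where "u = (h * t - h\<^sup>2 / 2) / \<sigma>\<^sup>2"
  have N: "0 \<le> N" using assms(4) by linarith
  have "u = h * ((t - h / 2) / \<sigma>\<^sup>2)"
    by (simp add: u_def power2_eq_square algebra_simps)
  moreover have "\<bar>t - h / 2\<bar> \<le> N + 1" using assms by linarith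
  ultimately have u: "\<bar>u\<bar> \<le> h * ((N + 1) / \<sigma>\<^sup>2)"
    using assms(1,2) by (simp add: abs_mult divide_right_mono)
  also have "\<dots> \<le> 1 * ((N + 1) / \<sigma>\<^sup>2)"
    using assms N by (intro mult_right_mono) auto
  finally have u1: "\<bar>u\<bar> \<le> (N + 1) / \<sigma>\<^sup>2" by simp
  have "\<bar>exp u - 1\<bar> \<le> h * ((N + 1) / \<sigma>\<^sup>2) * exp ((N + 1) / \<sigma>\<^sup>2)"
    using abs_exp_minus_one_le[of u] u u1 N assms(2)
    by (elim order_trans) (intro mult_mono, auto)
  then have "\<bar>(exp u - 1) / h\<bar> \<le> (N + 1) / \<sigma>\<^sup>2 * exp ((N + 1) / \<sigma>\<^sup>2)"
    using assms(2) by (simp add: abs_divide divide_le_eq mult_ac)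
  also have "\<dots> \<le> exp N / \<sigma>\<^sup>2 * exp ((N + 1) / \<sigma>\<^sup>2)"
    using exp_ge_add_one_self[of N] by (intro mult_right_mono divide_right_mono) (auto simp: add.commute)
  also have "\<dots> = exp (1 / \<sigma>\<^sup>2) / \<sigma>\<^sup>2 * exp ((1 + 1 / \<sigma>\<^sup>2) * N)"
    by (simp add: exp_add[symmetric] algebra_simps add_divide_distrib)
  finally show ?thesis by (simp add: u_def)
qed

lemma integral_lborel_translate:
  fixes f :: "'a::euclidean_space \<Rightarrow> real"
  assumes "f \<in> borel_measurable borel"
  shows "(\<integral>e. f (c + e) \<partial>lborel) = (\<integral>e. f e \<partial>lborel)"
proof -
  have "(\<integral>e. f e \<partial>distr lborel borel ((+) c)) = (\<integral>e. f (c + e) \<partial>lborel)"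
    using assms by (intro integral_distr) auto
  then show ?thesis by (simp add: lborel_distr_plus)
qed

lemma AE_lborel_translate:
  fixes c :: "'a::euclidean_space"
  assumes "AE y in lborel. P y"
  shows "AE e in lborel. P (c + e)"
proof (rule AE_distrD[of "(+) c" lborel borel])
  show "(+) c \<in> measurable lborel borel" by simp
  show "AE y in distr lborel borel ((+) c). P y"
    unfolding lborel_distr_plus by (rule assms)
qed

text \<open>
  Integration by parts at the level of difference quotients. By translation invariance of Lebesgue
  measure, the integral of the density \<open>\<phi>\<close> against the quotient
  \<open>(g (e + h a) - g e) / h\<close>, with \<open>a\<close> the \<open>i\<close>-th unit vector, equals the integral of \<open>g\<close> against the
  quotient \<open>(\<phi> (e - h a) - \<phi> e) / h\<close>. As \<open>h\<close> tends to \<open>0\<close>, the first tends to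
  \<open>\<integral> \<phi> \<partial>\<^sub>i g\<close> by the Lipschitz bound and differentiability almost everywhere, the second to
  \<open>\<integral> \<phi> g e\<^sub>i / \<sigma>\<^sup>2\<close>. This route avoids slicing the space into lines and the absolute continuity of
  \<open>g\<close> on them.
\<close>

theorem stein_identity_lipschitz:
  fixes g :: "real ^ 'n::finite \<Rightarrow> real"
  assumes \<sigma>: "\<sigma> > 0" and K: "K \<ge> 0"
    and lip: "\<And>u v. \<bar>g u - g v\<bar> \<le> K * norm (u - v)"
    and diff: "AE e in lborel. (\<lambda>t. g (e + t *\<^sub>R axis i 1)) differentiable (at 0)"
  shows "g \<in> borel_measurable borel"
    and "(\<lambda>e. deriv (\<lambda>t. g (e + t *\<^sub>R axis i 1)) 0) \<in> borel_measurable borel"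
    and "integrable lborel (\<lambda>e. iso_density \<sigma> e * g e)"
    and "integrable lborel (\<lambda>e. iso_density \<sigma> e * (g e * e $ i))"
    and "integrable lborel (\<lambda>e. iso_density \<sigma> e * deriv (\<lambda>t. g (e + t *\<^sub>R axis i 1)) 0)"
    and "(\<integral>e. iso_density \<sigma> e * (g e * e $ i) \<partial>lborel) =
      \<sigma>\<^sup>2 * (\<integral>e. iso_density \<sigma> e * deriv (\<lambda>t. g (e + t *\<^sub>R axis i 1)) 0 \<partial>lborel)"
proof -
  define N :: "real ^ 'n \<Rightarrow> real" where "N e = (\<Sum>j\<in>UNIV. \<bar>e $ j\<bar>)" for e
  define a :: "real ^ 'n" where "a = axis i 1"
  define h where "h n = 1 / real (Suc n)" for n
  define g' where "g' e = deriv (\<lambda>t. g (e + t *\<^sub>R a)) 0" for e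
  have h: "0 < h n" "h n \<le> 1" for n by (auto simp: h_def)
  have norm_a: "norm a = 1" by (simp add: a_def norm_axis_1)
  have N: "0 \<le> N e" "\<bar>e $ i\<bar> \<le> N e" "norm e \<le> N e" "1 + N e \<le> exp (N e)" for e
  proof -
    show "0 \<le> N e" by (simp add: N_def sum_nonneg)
    show "\<bar>e $ i\<bar> \<le> N e" unfolding N_def by (rule member_le_sum) auto
    show "norm e \<le> N e" unfolding N_def by (rule norm_le_l1_cart)
  qed (rule exp_ge_add_one_self)
  have cont: "continuous_on UNIV g"
    by (rule lipschitz_on_continuous_on[of K], rule lipschitz_onI)
      (use lip K in \<open>auto simp: dist_norm\<close>)
  show g_meas[measurable]: "g \<in> borel_measurable borel"
    by (rule borel_measurable_continuous_onI[OF cont])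
  have g'_meas[measurable]: "g' \<in> borel_measurable borel"
    unfolding g'_def
  proof (rule borel_measurable_deriv)
    show "continuous_on UNIV (\<lambda>t. g (e + t *\<^sub>R a))" for e
      by (intro continuous_on_compose2[OF cont]) (auto intro!: continuous_intros)
  qed simp
  then show "(\<lambda>e. deriv (\<lambda>t. g (e + t *\<^sub>R axis i 1)) 0) \<in> borel_measurable borel"
    by (simp add: g'_def[abs_def] a_def)

  define C where "C = \<bar>g 0\<bar> + K"
  have C: "C \<ge> 0" using K by (simp add: C_def)
  have g_bound: "\<bar>g e\<bar> \<le> C * exp (N e)" for e
  proof -
    have "\<bar>g e\<bar> \<le> \<bar>g 0\<bar> + K * norm e" using lip[of e 0] by simp
    also have "\<dots> \<le> \<bar>g 0\<bar> * (1 + N e) + K * (1 + N e)"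
      using N[of e] K by (intro add_mono mult_left_mono) (auto simp: mult_le_cancel_left1)
    also have "\<dots> = C * (1 + N e)" by (simp add: C_def algebra_simps)
    also have "\<dots> \<le> C * exp (N e)" using N(4) C by (intro mult_left_mono) auto
    finally show ?thesis .
  qed
  show int_g: "integrable lborel (\<lambda>e. iso_density \<sigma> e * g e)"
    by (rule integrable_iso_density_times[OF \<sigma> g_meas, of C 1]) (use g_bound in \<open>simp add: N_def\<close>)

  \<comment> \<open>\<open>D\<close> is the difference quotient of \<open>g\<close>, and \<open>q\<close> that of the density, divided by the density.\<close>
  define D where "D n e = (g (e + h n *\<^sub>R a) - g e) / h n" for n e
  define q where "q n e = (exp ((h n * e $ i - (h n)\<^sup>2 / 2) / \<sigma>\<^sup>2) - 1) / h n" for n and e :: "real ^ 'n"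
  have [measurable]: "D n \<in> borel_measurable borel" "q n \<in> borel_measurable borel" for n
    unfolding D_def q_def by measurable

  have D_bound: "\<bar>D n e\<bar> \<le> K" for n e
    using lip[of "e + h n *\<^sub>R a" e] h[of n] norm_a by (simp add: D_def abs_divide divide_le_eq)
  define b c where "b = 2 + 1 / \<sigma>\<^sup>2" and "c = C * (exp (1 / \<sigma>\<^sup>2) / \<sigma>\<^sup>2)"
  have gq_bound: "\<bar>g e * q n e\<bar> \<le> c * exp (b * N e)" for n e
  proof -
    have "\<bar>g e * q n e\<bar> \<le> (C * exp (N e)) * (exp (1 / \<sigma>\<^sup>2) / \<sigma>\<^sup>2 * exp ((1 + 1 / \<sigma>\<^sup>2) * N e))"
      unfolding abs_mult q_def
      by (intro mult_mono g_bound tilt_quotient_bound \<sigma> h N) (auto simp: C)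
    also have "\<dots> = c * exp (b * N e)"
      by (simp add: b_def c_def exp_add[symmetric] algebra_simps)
    finally show ?thesis .
  qed
  have int_gq: "integrable lborel (\<lambda>e. iso_density \<sigma> e * (g e * q n e))" for n
    by (rule integrable_iso_density_times[OF \<sigma>, of _ c b]) (use gq_bound in \<open>auto simp: N_def\<close>)
  have int_D: "integrable lborel (\<lambda>e. iso_density \<sigma> e * D n e)" for n
  proof (rule integrable_iso_density_times[OF \<sigma>, of _ K 0])
    show "\<bar>D n e\<bar> \<le> K * exp (0 * (\<Sum>j\<in>UNIV. \<bar>e $ j\<bar>))" for e using D_bound by simp
  qed simp

  \<comment> \<open>Both sides, times \<open>h\<close>, are the change of \<open>\<integral> \<phi> g\<close> when one of the two factors is translated.\<close>
  have swap: "(\<integral>e. iso_density \<sigma> e * D n e \<partial>lborel) = (\<integral>e. iso_density \<sigma> e * (g e * q n e) \<partial>lborel)" for n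
  proof -
    let ?G = "\<lambda>e. iso_density \<sigma> e * g e"
    have tilt: "iso_density \<sigma> (e - h n *\<^sub>R a) * g e = ?G e + h n * (iso_density \<sigma> e * (g e * q n e))" for e
      using h[of n] by (simp add: a_def iso_density_shift[OF \<sigma>] q_def field_simps)
    have diff_eq: "iso_density \<sigma> e * g (e + h n *\<^sub>R a) = ?G e + h n * (iso_density \<sigma> e * D n e)" for e
      using h[of n] by (simp add: D_def field_simps)
    have "(\<integral>e. iso_density \<sigma> e * g (e + h n *\<^sub>R a) \<partial>lborel) = (\<integral>e. iso_density \<sigma> (e - h n *\<^sub>R a) * g e \<partial>lborel)"
      using integral_lborel_translate[of "\<lambda>e. iso_density \<sigma> (e - h n *\<^sub>R a) * g e" "h n *\<^sub>R a"]
      by (simp add: add.commute)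
    then have "(\<integral>e. ?G e \<partial>lborel) + h n * (\<integral>e. iso_density \<sigma> e * D n e \<partial>lborel)
        = (\<integral>e. ?G e \<partial>lborel) + h n * (\<integral>e. iso_density \<sigma> e * (g e * q n e) \<partial>lborel)"
      unfolding tilt diff_eq using int_g int_D int_gq by simp
    then show ?thesis using h[of n] by simp
  qed

  have lim_D: "AE e in lborel. (\<lambda>n. iso_density \<sigma> e * D n e) \<longlonglongrightarrow> iso_density \<sigma> e * g' e"
    using diff
  proof eventually_elim
    case (elim e)
    then have "((\<lambda>t. g (e + t *\<^sub>R a)) has_field_derivative g' e) (at 0)"
      unfolding g'_def a_def by (simp add: DERIV_deriv_iff_real_differentiable)
    from DERIV_imp_quotient_LIMSEQ[OF this] have "(\<lambda>n. D n e) \<longlonglongrightarrow> g' e"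
      by (simp add: D_def h_def)
    then show ?case by (intro tendsto_intros)
  qed
  have lim_q: "(\<lambda>n. iso_density \<sigma> e * (g e * q n e)) \<longlonglongrightarrow> iso_density \<sigma> e * (g e * (e $ i / \<sigma>\<^sup>2))" for e
  proof -
    have "((\<lambda>t. exp ((t * e $ i - t\<^sup>2 / 2) * (1 / \<sigma>\<^sup>2))) has_field_derivative (e $ i * (1 / \<sigma>\<^sup>2))) (at 0)"
      by (rule derivative_eq_intros refl | simp)+
    then have "((\<lambda>t. exp ((t * e $ i - t\<^sup>2 / 2) / \<sigma>\<^sup>2)) has_field_derivative (e $ i / \<sigma>\<^sup>2)) (at 0)"
      by simp
    from DERIV_imp_quotient_LIMSEQ[OF this] have "(\<lambda>n. q n e) \<longlonglongrightarrow> e $ i / \<sigma>\<^sup>2"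
      by (simp add: q_def h_def)
    then show ?thesis by (intro tendsto_intros)
  qed
  have domD: "AE e in lborel. norm (iso_density \<sigma> e * D n e) \<le> K * iso_density \<sigma> e" for n
    using mult_left_mono[OF D_bound[of n] iso_density_nonneg[of \<sigma>]]
    by (auto simp: abs_mult iso_density_nonneg mult.commute)
  have intK: "integrable lborel (\<lambda>e::real^'n. K * iso_density \<sigma> e)"
    by (intro integrable_mult_right integrable_iso_density \<sigma>)
  have domq: "AE e in lborel. norm (iso_density \<sigma> e * (g e * q n e)) \<le> c * (iso_density \<sigma> e * exp (b * N e))" for n
  proof (rule AE_I2)
    fix e
    show "norm (iso_density \<sigma> e * (g e * q n e)) \<le> c * (iso_density \<sigma> e * exp (b * N e))"
      using mult_left_mono[OF gq_bound[of e n] iso_density_nonneg[of \<sigma> e]]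
      unfolding real_norm_def abs_mult[of "iso_density \<sigma> e"] abs_of_nonneg[OF iso_density_nonneg]
      by (simp add: mult_ac)
  qed
  have intq: "integrable lborel (\<lambda>e::real^'n. c * (iso_density \<sigma> e * exp (b * N e)))"
    unfolding N_def by (intro integrable_mult_right integrable_iso_density_exp \<sigma>)

  have int_g': "integrable lborel (\<lambda>e. iso_density \<sigma> e * g' e)"
    by (rule integrable_dominated_convergence[OF _ _ intK lim_D domD]) simp_all
  then show "integrable lborel (\<lambda>e. iso_density \<sigma> e * deriv (\<lambda>t. g (e + t *\<^sub>R axis i 1)) 0)"
    by (simp add: g'_def a_def)
  have int_ge: "integrable lborel (\<lambda>e. iso_density \<sigma> e * (g e * (e $ i / \<sigma>\<^sup>2)))"
    by (rule integrable_dominated_convergence[OF _ _ intq AE_I2[OF lim_q] domq]) simp_all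
  have eq: "\<sigma>\<^sup>2 * (iso_density \<sigma> e * (g e * (e $ i / \<sigma>\<^sup>2))) = iso_density \<sigma> e * (g e * e $ i)" for e
    using \<sigma> by simp
  show "integrable lborel (\<lambda>e. iso_density \<sigma> e * (g e * e $ i))"
    using integrable_mult_right[OF int_ge, of "\<sigma>\<^sup>2"] unfolding eq .

  have "(\<lambda>n. \<integral>e. iso_density \<sigma> e * D n e \<partial>lborel) \<longlonglongrightarrow> (\<integral>e. iso_density \<sigma> e * g' e \<partial>lborel)"
    by (rule integral_dominated_convergence[OF _ _ intK lim_D domD]) simp_all
  moreover have "(\<lambda>n. \<integral>e. iso_density \<sigma> e * (g e * q n e) \<partial>lborel)
      \<longlonglongrightarrow> (\<integral>e. iso_density \<sigma> e * (g e * (e $ i / \<sigma>\<^sup>2)) \<partial>lborel)"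
    by (rule integral_dominated_convergence[OF _ _ intq AE_I2[OF lim_q] domq]) simp_all
  ultimately have "(\<integral>e. iso_density \<sigma> e * g' e \<partial>lborel) = (\<integral>e. iso_density \<sigma> e * (g e * (e $ i / \<sigma>\<^sup>2)) \<partial>lborel)"
    unfolding swap by (rule LIMSEQ_unique)
  then have "\<sigma>\<^sup>2 * (\<integral>e. iso_density \<sigma> e * g' e \<partial>lborel) =
      (\<integral>e. \<sigma>\<^sup>2 * (iso_density \<sigma> e * (g e * (e $ i / \<sigma>\<^sup>2))) \<partial>lborel)"
    by simp
  then show "(\<integral>e. iso_density \<sigma> e * (g e * e $ i) \<partial>lborel) =
      \<sigma>\<^sup>2 * (\<integral>e. iso_density \<sigma> e * deriv (\<lambda>t. g (e + t *\<^sub>R axis i 1)) 0 \<partial>lborel)"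
    unfolding eq by (simp add: g'_def a_def)
qed

section \<open>Degrees of freedom\<close>

text \<open>
  Summing Stein's identity over the coordinates. The covariance only sees the noise \<open>\<epsilon>\<close>, because the
  mean of \<open>Y\<close> is \<open>\<theta>\<close>; that \<open>\<epsilon>\<close> is centred is Stein's identity for a constant function.
\<close>

lemma df_eq_expected_divergence_lipschitz:
  fixes f :: "real ^ 'n::finite \<Rightarrow> real ^ 'n" and \<theta> :: "real ^ 'n"
  assumes \<sigma>: "\<sigma> > 0" and "prob_space M" and normal: "isotropic_normal M \<sigma> \<epsilon>"
    and lip: "\<And>u v. norm (f u - f v) \<le> norm (u - v)"
    and diff: "\<And>i. AE y in lborel. coord_line f y i differentiable (at 0)"
  defines "Y \<equiv> \<lambda>w. \<theta> + \<epsilon> w"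
  shows "integrable M (\<lambda>w. f (Y w) $ i)"
    and "integrable M (\<lambda>w. f (Y w) $ i * Y w $ i)"
    and "integrable M (\<lambda>w. divergence f (Y w))"
    and "deg_freedom M \<sigma> f Y = (\<integral>w. divergence f (Y w) \<partial>M)"
proof -
  interpret prob_space M by fact
  have law: "distributed M lborel \<epsilon> (\<lambda>e. ennreal (iso_density \<sigma> e))"
    using normal by (simp add: isotropic_normal_def iso_density_def)
  note law_integrable = distributed_integrable[OF law _ iso_density_nonneg, simplified]
    and law_integral = distributed_integral[OF law _ iso_density_nonneg, simplified]
  define g where "g i e = f (\<theta> + e) $ i" for i e
  define g' where "g' i e = deriv (\<lambda>t. g i (e + t *\<^sub>R axis i 1)) 0" for i e
  have line: "(\<lambda>t. g i (e + t *\<^sub>R axis i 1)) = coord_line f (\<theta> + e) i" for i e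
    by (simp add: g_def coord_line_def add.assoc)
  have lip_g: "\<bar>g i u - g i v\<bar> \<le> 1 * norm (u - v)" for i u v
  proof -
    have "\<bar>g i u - g i v\<bar> \<le> norm (f (\<theta> + u) - f (\<theta> + v))"
      unfolding g_def vector_minus_component[symmetric] by (rule component_le_norm_cart)
    also have "\<dots> \<le> norm (u - v)" using lip[of "\<theta> + u" "\<theta> + v"] by simp
    finally show ?thesis by simp
  qed
  have diff_g: "AE e in lborel. (\<lambda>t. g i (e + t *\<^sub>R axis i 1)) differentiable (at 0)" for i
    unfolding line by (rule AE_lborel_translate[OF diff])
  note stein = stein_identity_lipschitz[OF \<sigma> zero_le_one lip_g diff_g, folded g'_def]
  have [measurable]: "g i \<in> borel_measurable borel" "g' i \<in> borel_measurable borel" for i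
    using stein(1,2)[of i] by (simp_all add: g'_def[abs_def])
  have int_g: "integrable M (\<lambda>w. g i (\<epsilon> w))" for i
    using stein(3)[of i] by (simp add: law_integrable)
  have int_g_eps: "integrable M (\<lambda>w. g i (\<epsilon> w) * \<epsilon> w $ i)" for i
    using stein(4)[of i] law_integrable[of "\<lambda>e. g i e * e $ i"] by simp
  have int_g': "integrable M (\<lambda>w. g' i (\<epsilon> w))" for i
    using stein(5)[of i] by (simp add: law_integrable)
  have stein_M: "(\<integral>w. g i (\<epsilon> w) * \<epsilon> w $ i \<partial>M) = \<sigma>\<^sup>2 * (\<integral>w. g' i (\<epsilon> w) \<partial>M)" for i
    using stein(6)[of i] law_integral[of "\<lambda>e. g i e * e $ i"] law_integral[of "g' i"] by simp
  \<comment> \<open>The constant function \<open>1\<close>, with Lipschitz constant \<open>0\<close>, gives the mean of \<open>\<epsilon>\<close>.\<close>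
  note stein_1 = stein_identity_lipschitz[OF \<sigma>, of 0 "\<lambda>_. 1"]
  have int_eps: "integrable M (\<lambda>w. \<epsilon> w $ i)" for i
    using stein_1(4)[of i] law_integrable[of "\<lambda>e. e $ i"] by simp
  have mean_eps: "(\<integral>w. \<epsilon> w $ i \<partial>M) = 0" for i
    using stein_1(6)[of i] law_integral[of "\<lambda>e. e $ i"] by simp

  have fY: "f (Y w) $ i = g i (\<epsilon> w)" for w i by (simp add: Y_def g_def)
  show "integrable M (\<lambda>w. f (Y w) $ i)" unfolding fY by (rule int_g)
  show "integrable M (\<lambda>w. f (Y w) $ i * Y w $ i)"
    unfolding fY using int_g[of i] int_g_eps[of i] by (simp add: Y_def distrib_left)
  have div: "divergence f (Y w) = (\<Sum>i\<in>UNIV. g' i (\<epsilon> w))" for w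
    unfolding divergence_def g'_def line Y_def ..
  show "integrable M (\<lambda>w. divergence f (Y w))"
    unfolding div using int_g' by simp
  have cov: "covar M (\<lambda>w. f (Y w) $ i) (\<lambda>w. Y w $ i) = \<sigma>\<^sup>2 * (\<integral>w. g' i (\<epsilon> w) \<partial>M)" for i
  proof -
    let ?m = "\<integral>w. g i (\<epsilon> w) \<partial>M"
    have "(\<integral>w. Y w $ i \<partial>M) = \<theta> $ i"
      using int_eps[of i] mean_eps[of i] by (simp add: Y_def prob_space)
    then have "covar M (\<lambda>w. f (Y w) $ i) (\<lambda>w. Y w $ i) =
        (\<integral>w. g i (\<epsilon> w) * \<epsilon> w $ i - ?m * \<epsilon> w $ i \<partial>M)"
      unfolding covar_def fY by (simp add: Y_def left_diff_distrib)
    also have "\<dots> = (\<integral>w. g i (\<epsilon> w) * \<epsilon> w $ i \<partial>M)"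
      using int_g_eps[of i] int_eps[of i] mean_eps[of i] by simp
    finally show ?thesis by (simp add: stein_M)
  qed
  show "deg_freedom M \<sigma> f Y = (\<integral>w. divergence f (Y w) \<partial>M)"
    unfolding deg_freedom_def div cov using \<sigma> int_g' by (simp add: sum_distrib_left[symmetric])
qed

theorem corollary4p4:
  fixes x :: "'n::finite \<Rightarrow> real ^ 'd::finite"
    and lam \<sigma> :: real
    and \<theta>star :: "real ^ 'n"
    and M :: "'w measure"
    and \<epsilon> :: "'w \<Rightarrow> real ^ 'n"
  assumes "CARD('d) > 1"
    and "inj x"
    and "lam > 0"
    and "\<sigma> > 0"
    and "prob_space M"
    and "isotropic_normal M \<sigma> \<epsilon>"
  defines "Y \<equiv> \<lambda>w. \<theta>star + \<epsilon> w"
  shows "(AE y in lborel.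
            (\<forall>i. coord_line (theta_hat x lam) y i differentiable (at 0)) \<and>
            (\<forall>I. max_indep_rows (mappend (A_mat x) B_mat) (active_set x lam y) I \<longrightarrow>
               minvertible I (gram_mat x lam) \<and>
               divergence (theta_hat x lam) y =
                 real CARD('n) - mtrace UNIV
                   (mprod I (mprod I (mtransp B_mat) (minv I (gram_mat x lam))) B_mat)))
       \<and> (\<forall>i. integrable M (\<lambda>w. theta_hat x lam (Y w) $ i)
              \<and> integrable M (\<lambda>w. theta_hat x lam (Y w) $ i * Y w $ i))
       \<and> integrable M (\<lambda>w. divergence (theta_hat x lam) (Y w))
       \<and> deg_freedom M \<sigma> (theta_hat x lam) Y
            = (\<integral>w. divergence (theta_hat x lam) (Y w) \<partial>M)"
proof -
  note lam = \<open>lam > 0\<close>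
  have diff: "AE y in lborel. \<forall>i. coord_line (theta_hat x lam) y i differentiable (at 0)"
    using AE_interior_active_set[OF lam, of x]
  proof eventually_elim
    case (elim y)
    obtain I where I: "max_indep_rows (mappend (A_mat x) B_mat) (active_set x lam y) I"
      using exists_max_indep_rows by metis
    then obtain W where "is_minv I (gram_mat x lam) W"
      using minvertible_gram_mat[OF lam] unfolding max_indep_rows_def minvertible_def by metis
    from coord_line_has_derivative[OF lam I this elim] show ?case
      unfolding real_differentiable_def by metis
  qed
  have formula: "AE y in lborel. \<forall>I. max_indep_rows (mappend (A_mat x) B_mat) (active_set x lam y) I \<longrightarrow>
      minvertible I (gram_mat x lam) \<and>
      divergence (theta_hat x lam) y = real CARD('n) - mtrace UNIV
        (mprod I (mprod I (mtransp B_mat) (minv I (gram_mat x lam))) B_mat)"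
    using AE_interior_active_set[OF lam, of x]
  proof eventually_elim
    case (elim y)
    show ?case
      using divergence_theta_hat[OF lam elim] minvertible_gram_mat[OF lam]
      unfolding max_indep_rows_def by metis
  qed
  have "AE y in lborel. coord_line (theta_hat x lam) y i differentiable (at 0)" for i
    using diff by eventually_elim (rule spec)
  note df = df_eq_expected_divergence_lipschitz[OF \<open>\<sigma> > 0\<close> \<open>prob_space M\<close>
      \<open>isotropic_normal M \<sigma> \<epsilon>\<close> theta_hat_lipschitz[OF lam] this, of \<theta>star]
  show ?thesis
    unfolding Y_def by (intro conjI allI AE_conjI diff formula df)
qed

end
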